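(* There exists a Dehn monster, i.e., there exists an infinite recursively presented group that is algorithmically finite.
   Context: For a finite set $X$, $F(X)$ is the free group on $X$, viewed as the set of freely reduced words in $X\cup X^{-1}$. A subset of $F(X)$ is computably enumerable if some algorithm enumerates its elements. A group $G$ is recursively presented if it has a presentation $\langle X\mid R\rangle$ with $X$ finite and $R\subseteq F(X)$ computably enumerable. A group $G$ generated by a finite set $X$, with canonical epimorphism $\eta:F(X)\to G$, is algorithmically finite if for every infinite computably enumerable subset $W\subseteq F(X)$ there exist two distinct words $u,v\in W$ with $\eta(u)=\eta(v)$ (this property does not depend on the choice of finite generating set). A Dehn monster is an infinite, recursively presented, algorithmically finite group. *)

theory Defs
  imports "HOL-Algebra.Generated_Groups" "HOL-Library.Nat_Bijection"
begin

section \<open>Free groups and presentations\<close>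

text \<open>The letter \<open>(x, False)\<close> stands for \<open>x\<close> and \<open>(x, True)\<close> for its formal inverse.\<close>

type_synonym 'a letter = "'a \<times> bool"
type_synonym 'a word = "'a letter list"

definition cancels :: "'a letter \<Rightarrow> 'a letter \<Rightarrow> bool" where
  "cancels a b \<longleftrightarrow> fst a = fst b \<and> snd a \<noteq> snd b"

definition reduced :: "'a word \<Rightarrow> bool" where
  "reduced w \<longleftrightarrow> successively (\<lambda>a b. \<not> cancels a b) w"

fun cons_reduce :: "'a letter \<Rightarrow> 'a word \<Rightarrow> 'a word" where
  "cons_reduce a [] = [a]"
| "cons_reduce a (b # w) = (if cancels a b then w else a # b # w)"

definition reduce :: "'a word \<Rightarrow> 'a word" where
  "reduce w = foldr cons_reduce w []"

definition free_group :: "'a set \<Rightarrow> 'a word monoid" where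
  "free_group X = \<lparr>carrier = {w. fst ` set w \<subseteq> X \<and> reduced w},
     monoid.mult = (\<lambda>u v. reduce (u @ v)), one = []\<rparr>"

definition normal_closure :: "('g, 'b) monoid_scheme \<Rightarrow> 'g set \<Rightarrow> 'g set" where
  "normal_closure G R = \<Inter> {N. N \<lhd> G \<and> R \<subseteq> N}"

definition presented_group :: "'a set \<Rightarrow> 'a word set \<Rightarrow> 'a word set monoid" where
  "presented_group X R = free_group X Mod normal_closure (free_group X) R"

text \<open>For \<open>x\<close> mapping letters into \<open>G\<close>, \<open>word_value G x\<close> is the canonical homomorphism
  from the free group into \<open>G\<close> that extends \<open>x\<close>.\<close>

definition letter_value :: "('g, 'b) monoid_scheme \<Rightarrow> ('a \<Rightarrow> 'g) \<Rightarrow> 'a letter \<Rightarrow> 'g" where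
  "letter_value G x a = (if snd a then inv\<^bsub>G\<^esub> (x (fst a)) else x (fst a))"

definition word_value :: "('g, 'b) monoid_scheme \<Rightarrow> ('a \<Rightarrow> 'g) \<Rightarrow> 'a word \<Rightarrow> 'g" where
  "word_value G x w = foldr (\<lambda>a g. letter_value G x a \<otimes>\<^bsub>G\<^esub> g) w \<one>\<^bsub>G\<^esub>"

section \<open>Computable enumerability\<close>

text \<open>Algorithms are Kleene's partial recursive functions. Terms carry no arity; a term may
  be applied to argument lists of any length and is undefined where no rule applies.
  On argument lists of one fixed length, the terms define exactly the partial recursive functions
  of that arity. \<open>computes f xs y\<close> means that \<open>f\<close> halts on \<open>xs\<close> with value \<open>y\<close>.\<close>

datatype recfun =
    Zero
  | Succ
  | Proj nat
  | Comp recfun "recfun list"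
  | PrimRec recfun recfun
  | Mu recfun

inductive computes :: "recfun \<Rightarrow> nat list \<Rightarrow> nat \<Rightarrow> bool" where
  zero: "computes Zero xs 0"
| succ: "computes Succ [x] (Suc x)"
| proj: "i < length xs \<Longrightarrow> computes (Proj i) xs (xs ! i)"
| comp: "list_all2 (\<lambda>g y. computes g xs y) gs ys \<Longrightarrow> computes f ys z \<Longrightarrow>
    computes (Comp f gs) xs z"
| prim_0: "computes f xs y \<Longrightarrow> computes (PrimRec f g) (0 # xs) y"
| prim_Suc: "computes (PrimRec f g) (n # xs) r \<Longrightarrow> computes g (n # r # xs) y \<Longrightarrow>
    computes (PrimRec f g) (Suc n # xs) y"
| mu: "computes f (n # xs) 0 \<Longrightarrow> (\<forall>m<n. \<exists>k. computes f (m # xs) (Suc k)) \<Longrightarrow>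
    computes (Mu f) xs n"

text \<open>A set of numbers is enumerated by an algorithm iff it is the range of a unary partial
  recursive function; partiality admits the empty set.\<close>

definition ce_nat :: "nat set \<Rightarrow> bool" where
  "ce_nat A \<longleftrightarrow> (\<exists>f. A = {y. \<exists>x. computes f [x] y})"

text \<open>Finite alphabets are enumerated, that is, taken to be of the form \<open>{..<n}\<close>, so that
  words have explicit numerical codes.\<close>

definition word_code :: "nat word \<Rightarrow> nat" where
  "word_code w = list_encode (map (\<lambda>(i, s). prod_encode (i, of_bool s)) w)"

definition computably_enumerable :: "nat word set \<Rightarrow> bool" where
  "computably_enumerable W \<longleftrightarrow> ce_nat (word_code ` W)"

section \<open>Dehn monsters\<close>

definition recursively_presented :: "('g, 'b) monoid_scheme \<Rightarrow> bool" where
  "recursively_presented G \<longleftrightarrow>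
    (\<exists>(n::nat) R. R \<subseteq> carrier (free_group {..<n}) \<and> computably_enumerable R \<and>
      G \<cong> presented_group {..<n} R)"

text \<open>The finite generating set is \<open>X = {x 0, \<dots>, x (n - 1)}\<close>, with the \<open>x i\<close> pairwise distinct;
  the free group on \<open>X\<close> is the free group on the indices, and \<open>word_value G x\<close> is the
  canonical epimorphism. The property does not depend on the choice of \<open>X\<close>.\<close>

definition algorithmically_finite :: "('g, 'b) monoid_scheme \<Rightarrow> bool" where
  "algorithmically_finite G \<longleftrightarrow>
    (\<exists>X (n::nat) x. X \<subseteq> carrier G \<and> generate G X = carrier G \<and> bij_betw x {..<n} X \<and>
      (\<forall>W \<subseteq> carrier (free_group {..<n}). infinite W \<longrightarrow> computably_enumerable W \<longrightarrow>
        (\<exists>u\<in>W. \<exists>v\<in>W. u \<noteq> v \<and> word_value G x u = word_value G x v)))"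

definition dehn_monster :: "('g, 'b) monoid_scheme \<Rightarrow> bool" where
  "dehn_monster G \<longleftrightarrow>
    group G \<and> infinite (carrier G) \<and> recursively_presented G \<and> algorithmically_finite G"

end

theory Submission
  imports Defs "HOL-Library.Z2" "HOL-Library.Function_Algebras"
begin

text \<open>The group is \<open>G = F3 / N\<close>, where \<open>F3\<close> is free on three letters and \<open>N\<close> is the normal closure of
  a set \<open>R\<close> that contains, for every program \<open>e\<close>, at most one relator \<open>r\<^sub>e = u v\<^sup>-\<^sup>1\<close>. Here \<open>u\<close>
  and \<open>v\<close> are distinct words in the set \<open>W\<^sub>e\<close> that \<open>e\<close> enumerates. If \<open>r\<^sub>e\<close> exists for every infinite
  \<open>W\<^sub>e\<close>, then \<open>G\<close> is algorithmically finite; the relators have to be so sparse that \<open>G\<close> remains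
  infinite.

  Sparseness is measured by the Magnus embedding \<open>\<mu>\<close> with \<open>\<mu> x\<^sub>i = 1 + x\<^sub>i\<close> into the power series in
  three noncommuting variables over the field with two elements. Let \<open>M\<close> be the ideal of the series
  without constant term. Only finitely many values of \<open>\<mu>\<close> exist modulo \<open>M\<^sup>k\<close>, so every
  infinite set of words contains distinct \<open>u\<close> and \<open>v\<close> with \<open>\<mu> u = \<mu> v\<close> modulo \<open>M\<^sup>k\<close>
  (\<open>exists_agreeing_pair\<close>). For the relator \<open>r\<^sub>e\<close> this is required with \<open>k = e + 2\<close>, whence
  \<open>\<mu> r\<^sub>e - 1 \<in> M\<^sup>e\<^sup>+\<^sup>2\<close> (\<open>agree_deep\<close>).

  The requirement is decidable, and whether a given list is a complete record of a computation of
  \<open>e\<close> is decidable as well (\<open>computes_iff_derivable\<close>). Hence a pair \<open>u\<close>, \<open>v\<close> together with a proof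
  that \<open>u, v \<in> W\<^sub>e\<close> is found by unbounded search, uniformly in \<open>e\<close> (\<open>computable_choice\<close>), and \<open>R\<close>
  is computably enumerable.

  That \<open>G\<close> is infinite is a case of the theorem of Golod and Shafarevich. Let \<open>I\<close> be the ideal
  generated by all \<open>\<mu> r\<^sub>e - 1\<close>. The elements of \<open>G\<close> span the algebra modulo \<open>I + M\<^sup>n\<close>, so it is enough that
  the dimension \<open>b\<^sub>n\<close> of this quotient is unbounded. As there is at most one relator for each \<open>e\<close>,
  of degree at least \<open>e + 2\<close>, the inequality of Golod and Shafarevich reads
  \<open>b\<^sub>n\<^sub>+\<^sub>1 \<ge> 1 + 3 b\<^sub>n - (b\<^sub>n\<^sub>-\<^sub>1 + b\<^sub>n\<^sub>-\<^sub>2 + \<dots>)\<close>, and it gives \<open>b\<^sub>n\<^sub>+\<^sub>1 \<ge> 1 + 2 b\<^sub>n\<close>. The proof below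
  avoids quotients and dimensions by working in the dual space: it counts the functionals that vanish
  on \<open>I + M\<^sup>n\<close>, of which there are \<open>2\<close> to the power \<open>b\<^sub>n\<close> (\<open>golod_shafarevich\<close>, \<open>card_invariants\<close>). Such a functional
  is a function on \<open>G\<close> with values in the field with two elements, and \<open>G\<close> cannot be finite if there
  are arbitrarily many of them (\<open>infinite_presented_group\<close>).\<close>

section \<open>Total computable functions\<close>

lemma computes_deterministic:
  "computes f xs y \<Longrightarrow> computes f xs z \<Longrightarrow> y = z"
proof (induction arbitrary: z rule: computes.induct)
  case (comp xs gs ys f w)
  from comp.prems obtain vs where vs: "list_all2 (\<lambda>g y. computes g xs y) gs vs" "computes f vs z"
    by (cases rule: computes.cases) auto
  have "ys = vs"
    using comp.IH(1) vs(1) by (auto simp: list_all2_conv_all_nth intro: nth_equalityI)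
  with vs(2) comp.IH(2) show ?case by blast
next
  case (prim_Suc f g n xs r y)
  from prim_Suc.prems obtain s where "computes (PrimRec f g) (n # xs) s" "computes g (n # s # xs) z"
    by (cases rule: computes.cases) auto
  with prim_Suc.IH show ?case by blast
next
  case (mu f n xs)
  from mu.prems have z: "computes f (z # xs) 0" "\<forall>m<z. \<exists>k. computes f (m # xs) (Suc k)"
    by (cases rule: computes.cases; auto)+
  show ?case
  proof (rule linorder_cases[of n z])
    assume "n < z"
    with z(2) obtain k where "computes f (n # xs) (Suc k)" by blast
    with mu.IH(1) show ?thesis by blast
  next
    assume "z < n"
    with mu.IH(2) z(1) show ?thesis by blast
  qed
next
  case (zero xs)
  then show ?case by (cases rule: computes.cases) auto
next
  case (succ x)
  then show ?case by (cases rule: computes.cases) auto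
next
  case (proj i xs)
  from proj(2) show ?case by (cases rule: computes.cases) auto
next
  case (prim_0 f xs y g)
  from prim_0.prems have "computes f xs z" by (cases rule: computes.cases) auto
  then show ?case by (rule prim_0.IH)
qed

lemma computes_Comp1:
  "computes g xs a \<Longrightarrow> computes f [a] z \<Longrightarrow> computes (Comp f [g]) xs z"
  by (rule computes.comp[where ys = "[a]"]) auto

lemma computes_Comp2:
  "computes g xs a \<Longrightarrow> computes h xs b \<Longrightarrow> computes f [a, b] z \<Longrightarrow> computes (Comp f [g, h]) xs z"
  by (rule computes.comp[where ys = "[a, b]"]) auto

lemma computes_Proj:
  "i < length xs \<Longrightarrow> y = xs ! i \<Longrightarrow> computes (Proj i) xs y"
  using computes.proj by blast

lemma computes_PrimRec_rec_nat:
  assumes "computes f xs b" "\<And>n r. computes g (n # r # xs) (s n r)"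
  shows "computes (PrimRec f g) (n # xs) (rec_nat b s n)"
  using assms by (induction n) (auto intro: computes.intros)

fun const_term :: "nat \<Rightarrow> recfun" where
  "const_term 0 = Zero"
| "const_term (Suc n) = Comp Succ [const_term n]"

lemma computes_const_term: "computes (const_term n) xs n"
  by (induction n) (auto intro: computes.intros computes_Comp1)

definition add_term :: recfun where
  "add_term = PrimRec (Proj 0) (Comp Succ [Proj 1])"

lemma computes_add_term: "computes add_term [m, n] (m + n)"
proof -
  have "computes add_term [m, n] (rec_nat n (\<lambda>_ r. Suc r) m)"
    unfolding add_term_def
    by (rule computes_PrimRec_rec_nat) (auto intro!: computes_Proj computes_Comp1[OF _ computes.succ])
  moreover have "rec_nat n (\<lambda>_ r. Suc r) m = m + n" by (induction m) auto
  ultimately show ?thesis by simp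
qed

definition pred_term :: recfun where
  "pred_term = PrimRec Zero (Proj 0)"

lemma computes_pred_term: "computes pred_term [m] (m - 1)"
proof -
  have "computes pred_term [m] (rec_nat 0 (\<lambda>n _. n) m)"
    unfolding pred_term_def
    by (rule computes_PrimRec_rec_nat) (auto intro: computes_Proj computes.intros)
  moreover have "rec_nat 0 (\<lambda>n _. n) m = m - 1" by (cases m) auto
  ultimately show ?thesis by simp
qed

definition sub_term :: recfun where
  "sub_term = Comp (PrimRec (Proj 0) (Comp pred_term [Proj 1])) [Proj 1, Proj 0]"

lemma computes_sub_term: "computes sub_term [m, n] (m - n)"
proof -
  have "computes sub_term [m, n] (rec_nat m (\<lambda>_ r. r - 1) n)"
    unfolding sub_term_def
    by (rule computes_Comp2[of _ _ n _ m]; (rule computes_PrimRec_rec_nat)?)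
      (auto intro!: computes_Proj computes_Comp1 computes_pred_term[unfolded One_nat_def])
  moreover have "rec_nat m (\<lambda>_ r. r - 1) n = m - n" by (induction n) auto
  ultimately show ?thesis by simp
qed

definition triangle_term :: recfun where
  "triangle_term = PrimRec Zero (Comp add_term [Proj 1, Comp Succ [Proj 0]])"

lemma computes_triangle_term: "computes triangle_term [n] (triangle n)"
proof -
  have "computes triangle_term [n] (rec_nat 0 (\<lambda>n r. r + Suc n) n)"
    unfolding triangle_term_def
    by (rule computes_PrimRec_rec_nat)
      (auto intro!: computes_Comp2[OF _ _ computes_add_term] computes_Comp1[OF _ computes.succ]
        computes_Proj computes.zero simp del: add_Suc_right)
  moreover have "rec_nat 0 (\<lambda>n r. r + Suc n) n = triangle n" by (induction n) auto
  ultimately show ?thesis by simp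
qed

definition pair_term :: recfun where
  "pair_term = Comp add_term [Comp triangle_term [add_term], Proj 0]"

lemma computes_pair_term: "computes pair_term [m, n] (prod_encode (m, n))"
  unfolding pair_term_def prod_encode_def
  by (auto intro!: computes_Comp2[OF _ _ computes_add_term] computes_Comp1[OF _ computes_triangle_term]
      computes_add_term computes_Proj)

text \<open>The diagonal \<open>m + n\<close> that contains \<open>prod_encode (m, n)\<close> is found by counting up to the code:
  the diagonal changes exactly when a triangular number is reached. This is how a pair is decoded
  by primitive recursion on a single number.\<close>

definition diagonal :: "nat \<Rightarrow> nat" where
  "diagonal = rec_nat 0 (\<lambda>z s. s + (1 - (triangle (Suc s) - Suc z)))"

lemma triangle_diagonal: "triangle (diagonal z) \<le> z \<and> z < triangle (Suc (diagonal z))"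
proof (induction z)
  case (Suc z)
  then show ?case
    by (cases "triangle (Suc (diagonal z)) \<le> Suc z") (auto simp: diagonal_def)
qed (simp add: diagonal_def)

lemma triangle_mono: "m \<le> n \<Longrightarrow> triangle m \<le> triangle n"
  by (rule lift_Suc_mono_le[of triangle]) auto

lemma diagonal_prod_encode: "diagonal (prod_encode (m, n)) = m + n"
proof -
  let ?z = "prod_encode (m, n)"
  have z: "triangle (m + n) \<le> ?z" "?z < triangle (Suc (m + n))"
    by (auto simp: prod_encode_def)
  have "\<not> Suc (diagonal ?z) \<le> m + n" "\<not> Suc (m + n) \<le> diagonal ?z"
    using triangle_diagonal[of ?z] z triangle_mono[of "Suc (diagonal ?z)" "m + n"]
      triangle_mono[of "Suc (m + n)" "diagonal ?z"] by linarith+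
  then show ?thesis by linarith
qed

definition diagonal_term :: recfun where
  "diagonal_term = PrimRec Zero (Comp add_term [Proj 1, Comp sub_term [const_term 1,
     Comp sub_term [Comp triangle_term [Comp Succ [Proj 1]], Comp Succ [Proj 0]]]])"

lemma computes_diagonal_term: "computes diagonal_term [z] (diagonal z)"
  unfolding diagonal_term_def diagonal_def
  by (rule computes_PrimRec_rec_nat)
    (auto intro!: computes_Comp2[OF _ _ computes_add_term] computes_Comp2[OF _ _ computes_sub_term]
      computes_Comp1[OF _ computes_triangle_term] computes_const_term[of "Suc 0"]
      computes_Comp1[OF _ computes.succ] computes_Proj computes.zero simp del: triangle_Suc diff_Suc_Suc)

definition fst_term :: recfun where
  "fst_term = Comp sub_term [Proj 0, Comp triangle_term [diagonal_term]]"

definition snd_term :: recfun where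
  "snd_term = Comp sub_term [diagonal_term, fst_term]"

lemma computes_fst_term: "computes fst_term [prod_encode (m, n)] m"
proof -
  have "computes fst_term [z] (z - triangle (diagonal z))" for z
    unfolding fst_term_def
    by (auto intro!: computes_Comp2[OF _ _ computes_sub_term] computes_Comp1[OF _ computes_triangle_term]
        computes_diagonal_term computes_Proj)
  from this[of "prod_encode (m, n)"] show ?thesis
    by (simp only: diagonal_prod_encode) (simp add: prod_encode_def)
qed

lemma computes_snd_term: "computes snd_term [prod_encode (m, n)] n"
proof -
  have "computes snd_term [prod_encode (m, n)] (diagonal (prod_encode (m, n)) - m)"
    unfolding snd_term_def
    by (intro computes_Comp2[OF _ _ computes_sub_term] computes_diagonal_term computes_fst_term)
  then show ?thesis by (simp add: diagonal_prod_encode)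
qed

text \<open>With codes attached to types, computability of functions on pairs, lists and words can be
  stated and proved without mentioning codes. On words, \<open>enc\<close> coincides with \<open>word_code\<close>.\<close>

class enc =
  fixes enc :: "'a \<Rightarrow> nat"
  assumes inj_enc: "inj enc"

lemma enc_eq_iff [simp]: "enc x = enc y \<longleftrightarrow> x = y"
  using inj_enc by (auto dest: injD)

instantiation nat :: enc
begin
definition "enc (n::nat) = n"
instance by standard (auto simp: enc_nat_def inj_on_def)
end

instantiation bool :: enc
begin
definition "enc (b::bool) = (of_bool b :: nat)"
instance by standard (auto simp: enc_bool_def inj_on_def)
end

instantiation prod :: (enc, enc) enc
begin
definition "enc p = prod_encode (enc (fst p), enc (snd p))"
instance by standard (auto simp: enc_prod_def inj_on_def)
end

instantiation list :: (enc) enc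
begin
definition "enc xs = list_encode (map enc xs)"
instance by standard (auto simp: enc_list_def inj_on_def list_encode_eq inj_map_eq_map[OF inj_enc])
end

lemma enc_Nil: "enc [] = 0" and enc_Cons: "enc (x # xs) = Suc (enc (x, xs))"
  by (simp_all add: enc_list_def enc_prod_def)

lemma enc_nat_list: "enc (xs :: nat list) = list_encode xs"
proof -
  have "(enc :: nat \<Rightarrow> nat) = id" by (auto simp: enc_nat_def)
  then show ?thesis by (simp add: enc_list_def)
qed

text \<open>Unary functions suffice, because several arguments can be packed into a pair. The behaviour of
  the term on numbers that are not codes is left open.

  The closure rules below are meant for resolution. Each of them speaks of functions
  \<open>\<lambda>x. t x\<close> with one argument, so repeated application of the rules decomposes the body of a
  definition down to variables and constants.\<close>

definition computable :: "('a::enc \<Rightarrow> 'b::enc) \<Rightarrow> bool" where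
  "computable f \<longleftrightarrow> (\<exists>t. \<forall>x. computes t [enc x] (enc (f x)))"

named_theorems computable_intros

lemma computableI: "(\<And>x. computes t [enc x] (enc (f x))) \<Longrightarrow> computable f"
  unfolding computable_def by blast

lemma computableE: assumes "computable f" obtains t where "\<And>x. computes t [enc x] (enc (f x))"
  using assms unfolding computable_def by blast

lemma computable_id [computable_intros]: "computable (\<lambda>x. x)"
  by (rule computableI[of "Proj 0"]) (auto intro: computes_Proj)

lemma computable_const [computable_intros]: "computable (\<lambda>x. c)"
  by (rule computableI) (rule computes_const_term)

lemma computable_compose:
  assumes "computable f" "computable g"
  shows "computable (\<lambda>x. f (g x))"
proof -
  obtain t s where "\<And>x. computes t [enc x] (enc (f x))" "\<And>x. computes s [enc x] (enc (g x))"
    using assms unfolding computable_def by auto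
  then show ?thesis by (intro computableI[of "Comp t [s]"] computes_Comp1) auto
qed

lemma computable_binary:
  assumes t: "\<And>a b. computes t [enc a, enc b] (enc (h a b))" and "computable f" "computable g"
  shows "computable (\<lambda>x. h (f x) (g x))"
proof -
  obtain tf tg where "\<And>x. computes tf [enc x] (enc (f x))" "\<And>x. computes tg [enc x] (enc (g x))"
    using assms unfolding computable_def by auto
  with t show ?thesis by (intro computableI[of "Comp t [tf, tg]"] computes_Comp2) auto
qed

lemma computable_Pair [computable_intros]:
  "computable f \<Longrightarrow> computable g \<Longrightarrow> computable (\<lambda>x. (f x, g x))"
  by (rule computable_binary[of pair_term]) (auto simp: enc_prod_def computes_pair_term)

lemma computable_fst [computable_intros]:
  "computable f \<Longrightarrow> computable (\<lambda>x. fst (f x))"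
  by (rule computable_compose[of fst])
    (auto intro!: computableI[of fst_term] simp: enc_prod_def computes_fst_term)

lemma computable_snd [computable_intros]:
  "computable f \<Longrightarrow> computable (\<lambda>x. snd (f x))"
  by (rule computable_compose[of snd])
    (auto intro!: computableI[of snd_term] simp: enc_prod_def computes_snd_term)

text \<open>Computability of a function of two variables is proved once, on pairs; this rule and the next
  give it the form in which it applies to arbitrary subterms.\<close>

lemma computable_fun2:
  "computable (\<lambda>p. h (fst p) (snd p)) \<Longrightarrow> computable f \<Longrightarrow> computable g \<Longrightarrow>
    computable (\<lambda>x. h (f x) (g x))"
  using computable_compose[of "\<lambda>p. h (fst p) (snd p)" "\<lambda>x. (f x, g x)"] by (simp add: computable_Pair)

lemma computable_fun3:
  "computable (\<lambda>p. h (fst (fst p)) (snd (fst p)) (snd p)) \<Longrightarrow>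
    computable f \<Longrightarrow> computable g \<Longrightarrow> computable k \<Longrightarrow>
    computable (\<lambda>x. h (f x) (g x) (k x))"
  using computable_compose[of "\<lambda>p. h (fst (fst p)) (snd (fst p)) (snd p)" "\<lambda>x. ((f x, g x), k x)"]
  by (simp add: computable_Pair)

lemma computable_Suc [computable_intros]:
  "computable f \<Longrightarrow> computable (\<lambda>x. Suc (f x))"
  by (rule computable_compose[of Suc]) (auto intro!: computableI[of Succ] computes.succ simp: enc_nat_def)

lemma computable_add [computable_intros]:
  "computable f \<Longrightarrow> computable g \<Longrightarrow> computable (\<lambda>x. f x + g x :: nat)"
  by (rule computable_binary[of add_term]) (auto simp: enc_nat_def computes_add_term)

lemma computable_diff [computable_intros]:
  "computable f \<Longrightarrow> computable g \<Longrightarrow> computable (\<lambda>x. f x - g x :: nat)"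
  by (rule computable_binary[of sub_term]) (auto simp: enc_nat_def computes_sub_term)

lemma computable_enc [computable_intros]:
  "computable f \<Longrightarrow> computable (\<lambda>x. enc (f x))"
  by (rule computable_compose[of enc]) (auto intro!: computableI[of "Proj 0"] computes_Proj simp: enc_nat_def)

lemma computable_prod_decode [computable_intros]:
  "computable f \<Longrightarrow> computable (\<lambda>x. prod_decode (f x))"
  by (rule computable_compose[of prod_decode])
    (auto intro!: computableI[of "Proj 0"] computes_Proj simp: enc_nat_def enc_prod_def)

lemma computable_list_decode [computable_intros]:
  "computable f \<Longrightarrow> computable (\<lambda>x. list_decode (f x))"
  by (rule computable_compose[of list_decode])
    (auto intro!: computableI[of "Proj 0"] computes_Proj simp: enc_nat_def enc_nat_list)

text \<open>The variables bound by the step function become projections of one argument. In this form the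
  premise speaks of a unary function again, and the rule applies by higher-order pattern
  unification.\<close>

lemma computable_rec_nat [computable_intros]:
  assumes "computable b" "computable (\<lambda>p. s (fst p) (fst (snd p)) (snd (snd p)))" "computable k"
  shows "computable (\<lambda>x. rec_nat (b x) (\<lambda>n r. s n r x) (k x))"
proof -
  obtain tb ts tk where t: "\<And>x. computes tb [enc x] (enc (b x))"
      "\<And>n r x. computes ts [enc (n, r, x)] (enc (s n r x))"
      "\<And>x. computes tk [enc x] (enc (k x))"
    using assms unfolding computable_def by auto
  let ?ts = "Comp ts [Comp pair_term [Proj 0, Comp pair_term [Proj 1, Proj 2]]]"
  have ts: "computes ?ts [n, enc r, enc x] (enc (s n r x))" for n r x
    using t(2)[of n r x]
    by (auto intro!: computes_Comp1[of _ _ "enc (n, r, x)"] computes_Comp2[OF _ _ computes_pair_term]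
        computes_Proj simp: enc_prod_def enc_nat_def)
  have "computes (PrimRec tb ?ts) [n, enc x] (enc (rec_nat (b x) (\<lambda>n r. s n r x) n))" for n x
  proof (induction n)
    case (Suc n)
    from computes.prim_Suc[OF Suc ts] show ?case by simp
  qed (auto intro: computes.prim_0 t(1))
  then show ?thesis
    using t(3)
    by (intro computableI[of "Comp (PrimRec tb ?ts) [tk, Proj 0]"] computes_Comp2)
      (auto intro: computes_Proj simp: enc_nat_def)
qed

text \<open>The condition is a number \<open>0\<close> or \<open>1\<close>, on which \<open>PrimRec\<close> branches. Both branches are
  evaluated when the condition is true, which is harmless for total functions.\<close>

lemma computable_if [computable_intros]:
  assumes "computable c" "computable f" "computable g"
  shows "computable (\<lambda>x. if c x then f x else g x)"
proof -
  obtain tc tf tg where t: "\<And>x. computes tc [enc x] (enc (c x))"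
      "\<And>x. computes tf [enc x] (enc (f x))" "\<And>x. computes tg [enc x] (enc (g x))"
    using assms unfolding computable_def by auto
  have **: "computes (PrimRec tg (Comp tf [Proj 2])) [enc b, enc x] (enc (if b then f x else g x))" for b x
    by (auto simp: enc_bool_def intro!: computes.prim_0 computes.prim_Suc t computes_Comp1[OF _ t(2)] computes_Proj)
  then show ?thesis
    using t(1) by (intro computableI[of "Comp (PrimRec tg (Comp tf [Proj 2])) [tc, Proj 0]"] computes_Comp2[OF _ _ **])
      (auto intro: computes_Proj)
qed

lemma computable_conj [computable_intros]:
  assumes "computable f" "computable g"
  shows "computable (\<lambda>x. f x \<and> g x)"
proof -
  have "computable (\<lambda>x. if f x then g x else False)" by (intro computable_if computable_const assms)
  also have "(\<lambda>x. if f x then g x else False) = (\<lambda>x. f x \<and> g x)" by auto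
  finally show ?thesis .
qed

lemma computable_not [computable_intros]:
  assumes "computable f"
  shows "computable (\<lambda>x. \<not> f x)"
proof -
  have "computable (\<lambda>x. if f x then False else True)" by (intro computable_if computable_const assms)
  also have "(\<lambda>x. if f x then False else True) = (\<lambda>x. \<not> f x)" by auto
  finally show ?thesis .
qed

lemma computable_disj [computable_intros]:
  assumes "computable f" "computable g"
  shows "computable (\<lambda>x. f x \<or> g x)"
proof -
  have "computable (\<lambda>x. if f x then True else g x)" by (intro computable_if computable_const assms)
  also have "(\<lambda>x. if f x then True else g x) = (\<lambda>x. f x \<or> g x)" by auto
  finally show ?thesis .
qed

lemma computable_eq [computable_intros]:
  assumes "computable f" "computable g" shows "computable (\<lambda>x. f x = g x)"
proof -
  have "computable (\<lambda>x. 1 - ((enc (f x) - enc (g x)) + (enc (g x) - enc (f x))))" (is "computable ?d")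
    by (intro computable_intros assms)
  then obtain t where t: "\<And>x. computes t [enc x] (?d x)" unfolding computable_def enc_nat_def by blast
  have "?d x = enc (f x = g x)" for x
    using enc_eq_iff[of "f x" "g x"] by (auto simp: enc_bool_def simp del: enc_eq_iff)
  with t show ?thesis by (intro computableI[of t]) (simp only:)
qed

lemma computable_less [computable_intros]:
  assumes "computable f" "computable g" shows "computable (\<lambda>x. f x < (g x :: nat))"
proof -
  have "computable (\<lambda>x. Suc (f x) - g x = 0)" by (intro computable_intros assms)
  then show ?thesis by (simp add: Suc_le_eq)
qed

text \<open>A number is its own code; so a term that computes the codes of the values of \<open>f\<close> computes \<open>f\<close>.\<close>

lemma computable_of_code: "computable (\<lambda>x. enc (f x)) \<Longrightarrow> computable f"
  by (auto simp: computable_def enc_nat_def)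

lemma computable_Cons [computable_intros]:
  assumes "computable f" "computable g"
  shows "computable (\<lambda>x. f x # g x)"
proof (rule computable_of_code)
  have "computable (\<lambda>x. Suc (enc (f x, g x)))" by (intro computable_intros assms)
  then show "computable (\<lambda>x. enc (f x # g x))" by (simp add: enc_Cons)
qed

text \<open>The code of a nonempty list is the successor of the code of head and tail. The predecessor of the
  code \<open>0\<close> of the empty list is \<open>0\<close> again, which need not be the code of a pair, hence the default.\<close>

definition uncons :: "'a list \<Rightarrow> 'a \<times> 'a list" where
  "uncons xs = (case xs of [] \<Rightarrow> (undefined, []) | y # ys \<Rightarrow> (y, ys))"

lemma computable_uncons: "computable f \<Longrightarrow> computable (\<lambda>x. uncons (f x))"
proof (rule computable_of_code)
  assume f: "computable f"
  have "enc (uncons (f x)) = (if f x = [] then enc (undefined :: 'b, [] :: 'b list) else enc (f x) - 1)" for x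
    by (cases "f x") (auto simp: uncons_def enc_Cons)
  then show "computable (\<lambda>x. enc (uncons (f x)))"
    by (simp only:) (intro computable_intros f)
qed

lemma computable_case_list [computable_intros]:
  assumes "computable f" "computable n" "computable (\<lambda>p. c (fst (fst p)) (snd (fst p)) (snd p))"
  shows "computable (\<lambda>x. case f x of [] \<Rightarrow> n x | y # ys \<Rightarrow> c y ys x)"
proof -
  have "(case f x of [] \<Rightarrow> n x | y # ys \<Rightarrow> c y ys x) =
      (if f x = [] then n x else c (fst (uncons (f x))) (snd (uncons (f x))) x)" for x
    by (cases "f x") (auto simp: uncons_def)
  then show ?thesis
    by (simp only:) (intro computable_intros assms computable_fun3[OF assms(3)] computable_uncons)
qed

section \<open>Computable operations on lists\<close>

lemma length_le_enc: "length xs \<le> enc xs"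
proof (induction xs)
  case (Cons x xs)
  then show ?case
    using le_prod_encode_2[of "enc xs" "enc x"] by (simp add: enc_Cons enc_prod_def)
qed simp

text \<open>Recursion over a list becomes iteration of one step on the remaining list and the accumulator.
  The step does nothing on the empty list, so any number of steps that is at least the length will
  do, and the code of the list is such a number.\<close>

lemma fold_as_iteration:
  assumes "length xs \<le> n"
  shows "rec_nat (xs, b) (\<lambda>_ s. case fst s of [] \<Rightarrow> s | y # ys \<Rightarrow> (ys, f y (snd s))) n = ([], fold f xs b)"
proof -
  let ?step = "\<lambda>_ s. case fst s of [] \<Rightarrow> s | y # ys \<Rightarrow> (ys, f y (snd s))"
  have "rec_nat (xs, b) ?step n = (drop n xs, fold f (take n xs) b)" for n
  proof (induction n)
    case (Suc n)
    show ?case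
    proof (cases "n < length xs")
      case True
      then show ?thesis by (simp add: Suc Cons_nth_drop_Suc[symmetric] take_Suc_conv_app_nth)
    qed (simp add: Suc)
  qed simp
  with assms show ?thesis by simp
qed

lemma computable_fold:
  assumes "computable L" "computable B" "computable (\<lambda>p. F (fst (fst p)) (snd (fst p)) (snd p))"
  shows "computable (\<lambda>x. fold (\<lambda>a b. F a b x) (L x) (B x))"
proof -
  have "computable (\<lambda>x. snd (rec_nat (L x, B x)
      (\<lambda>_ s. case fst s of [] \<Rightarrow> s | y # ys \<Rightarrow> (ys, F y (snd s) x)) (enc (L x))))"
    by (intro computable_intros assms(1,2) computable_fun3[OF assms(3)])
  moreover have "snd (rec_nat (L x, B x)
      (\<lambda>_ s. case fst s of [] \<Rightarrow> s | y # ys \<Rightarrow> (ys, F y (snd s) x)) (enc (L x)))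
    = fold (\<lambda>a b. F a b x) (L x) (B x)" for x
    using fold_as_iteration[OF length_le_enc, of "L x" "B x" "\<lambda>a b. F a b x"] by simp
  ultimately show ?thesis by simp
qed

lemma computable_rev: assumes "computable L" shows "computable (\<lambda>x. rev (L x))"
proof -
  have "computable (\<lambda>x. fold (\<lambda>a b. a # b) (L x) [])"
    by (intro computable_fold computable_intros assms)
  then show ?thesis by (simp add: fold_Cons_rev)
qed

lemma computable_foldr [computable_intros]:
  assumes "computable L" "computable B" "computable (\<lambda>p. F (fst (fst p)) (snd (fst p)) (snd p))"
  shows "computable (\<lambda>x. foldr (\<lambda>a b. F a b x) (L x) (B x))"
  unfolding foldr_conv_fold by (intro computable_fold computable_rev assms)

lemma computable_map [computable_intros]:
  assumes "computable L" "computable (\<lambda>p. F (fst p) (snd p))"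
  shows "computable (\<lambda>x. map (\<lambda>a. F a x) (L x))"
proof -
  have "computable (\<lambda>x. foldr (\<lambda>a b. F a x # b) (L x) [])"
    by (intro computable_intros computable_fun2[OF assms(2)] assms)
  moreover have "foldr (\<lambda>a b. F a x # b) L' [] = map (\<lambda>a. F a x) L'" for x L'
    by (induction L') auto
  ultimately show ?thesis by simp
qed

lemma computable_append [computable_intros]:
  assumes "computable f" "computable g" shows "computable (\<lambda>x. f x @ g x)"
proof -
  have "computable (\<lambda>x. foldr (\<lambda>a b. a # b) (f x) (g x))"
    by (intro computable_intros assms)
  moreover have "foldr (\<lambda>a b. a # b) xs ys = xs @ ys" for xs ys :: "'b list"
    by (induction xs) auto
  ultimately show ?thesis by simp
qed

lemma computable_concat [computable_intros]:
  assumes "computable f" shows "computable (\<lambda>x. concat (f x))"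
proof -
  have "computable (\<lambda>x. foldr (\<lambda>a b. a @ b) (f x) [])"
    by (intro computable_intros assms)
  then show ?thesis by (simp add: concat_conv_foldr)
qed

lemma computable_list_ball [computable_intros]:
  assumes "computable L" "computable (\<lambda>p. F (fst p) (snd p))"
  shows "computable (\<lambda>x. \<forall>a\<in>set (L x). F a x)"
proof -
  have "computable (\<lambda>x. foldr (\<lambda>a b. F a x \<and> b) (L x) True)"
    by (intro computable_intros computable_fun2[OF assms(2)] assms)
  moreover have "foldr (\<lambda>a b. F a x \<and> b) L' True \<longleftrightarrow> (\<forall>a\<in>set L'. F a x)" for x L'
    by (induction L') auto
  ultimately show ?thesis by simp
qed

lemma computable_list_bex [computable_intros]:
  assumes "computable L" "computable (\<lambda>p. F (fst p) (snd p))"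
  shows "computable (\<lambda>x. \<exists>a\<in>set (L x). F a x)"
proof -
  have "computable (\<lambda>x. foldr (\<lambda>a b. F a x \<or> b) (L x) False)"
    by (intro computable_intros computable_fun2[OF assms(2)] assms)
  moreover have "foldr (\<lambda>a b. F a x \<or> b) L' False \<longleftrightarrow> (\<exists>a\<in>set L'. F a x)" for x L'
    by (induction L') auto
  ultimately show ?thesis by simp
qed

lemma computable_member [computable_intros]:
  assumes "computable f" "computable L" shows "computable (\<lambda>x. f x \<in> set (L x))"
proof -
  have "computable (\<lambda>x. \<exists>a\<in>set (L x). a = f x)"
    by (intro computable_intros assms computable_compose[OF assms(1)])
  then show ?thesis by (simp add: Bex_def)
qed

lemma computable_all_less [computable_intros]:
  assumes "computable k" "computable (\<lambda>p. F (fst p) (snd p))"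
  shows "computable (\<lambda>x. \<forall>m<(k x :: nat). F m x)"
proof -
  have "computable (\<lambda>x. rec_nat True (\<lambda>m r. F m x \<and> r) (k x))"
    by (intro computable_intros computable_fun2[OF assms(2)] assms)
  moreover have "rec_nat True (\<lambda>m r. F m x \<and> r) n \<longleftrightarrow> (\<forall>m<n. F m x)" for x n
    by (induction n) (auto simp: less_Suc_eq)
  ultimately show ?thesis by simp
qed

lemma computable_drop [computable_intros]:
  assumes "computable k" "computable L" shows "computable (\<lambda>x. drop (k x) (L x))"
proof -
  have "computable (\<lambda>x. rec_nat (L x) (\<lambda>_ r. case r of [] \<Rightarrow> [] | y # ys \<Rightarrow> ys) (k x))"
    by (intro computable_intros assms)
  moreover have "rec_nat xs (\<lambda>_ r. case r of [] \<Rightarrow> [] | y # ys \<Rightarrow> ys) n = drop n xs"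
    for xs :: "'b list" and n
  proof (induction n)
    case (Suc n)
    have "drop (Suc n) xs = tl (drop n xs)" by (simp add: drop_Suc tl_drop)
    with Suc show ?case by (simp add: tl_def)
  qed simp
  ultimately show ?thesis by simp
qed

text \<open>The two lists are traversed together: the state of the fold is the unread part of the second
  list and the verdict so far.\<close>

lemma computable_list_all2 [computable_intros]:
  assumes "computable f" "computable g" "computable (\<lambda>p. P (fst (fst p)) (snd (fst p)) (snd p))"
  shows "computable (\<lambda>x. list_all2 (\<lambda>a b. P a b x) (f x) (g x))"
proof -
  define F where "F = (\<lambda>a s x. case fst s of [] \<Rightarrow> ([], False) | b # bs \<Rightarrow> (bs, snd s \<and> P a b x))"
  define R where "R = (\<lambda>x. fold (\<lambda>a s. F a s x) (f x) (g x, True))"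
  have "computable R"
    unfolding R_def F_def by (intro computable_fold computable_intros assms computable_fun3[OF assms(3)])
  moreover have "fst (fold (\<lambda>a s. F a s x) as (bs, ok)) = [] \<and> snd (fold (\<lambda>a s. F a s x) as (bs, ok))
      \<longleftrightarrow> ok \<and> list_all2 (\<lambda>a b. P a b x) as bs" for x as bs ok
  proof (induction as arbitrary: bs ok)
    case (Cons a as)
    have "\<not> (fst (fold (\<lambda>a s. F a s x) as ([], False)) = [] \<and> snd (fold (\<lambda>a s. F a s x) as ([], False)))"
      by (simp add: Cons.IH)
    with Cons.IH show ?case by (cases bs) (auto simp: F_def)
  qed auto
  then have "(\<lambda>x. list_all2 (\<lambda>a b. P a b x) (f x) (g x)) = (\<lambda>x. fst (R x) = [] \<and> snd (R x))"
    by (auto simp: R_def)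
  ultimately show ?thesis by (simp only:) (intro computable_intros)
qed

section \<open>A universal machine\<close>

text \<open>To run a program from its code takes an unbounded search, but to check a complete record of a
  computation does not. A record is a list of claims \<open>(e, xs, y)\<close>, saying that program \<open>e\<close> halts on
  \<open>xs\<close> with value \<open>y\<close>; every claim has to follow, by one of the rules of \<open>computes\<close>, from claims
  further down the list. A search through all records then simulates all programs.\<close>

type_synonym claim = "nat \<times> nat list \<times> nat"

primrec prog_code :: "recfun \<Rightarrow> nat" where
  "prog_code Zero = prod_encode (0, 0)"
| "prog_code Succ = prod_encode (1, 0)"
| "prog_code (Proj i) = prod_encode (2, i)"
| "prog_code (Comp f gs) = prod_encode (3, prod_encode (prog_code f, list_encode (map prog_code gs)))"
| "prog_code (PrimRec f g) = prod_encode (4, prod_encode (prog_code f, prog_code g))"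
| "prog_code (Mu f) = prod_encode (5, prog_code f)"

text \<open>The disjuncts are the rules of \<open>computes\<close>, one for each tag \<open>t\<close> of a program code. Intermediate
  values of a composition or a recursion are looked up in \<open>D\<close>, so all quantifiers are bounded and
  the check is computable.\<close>

definition justified :: "claim list \<Rightarrow> claim \<Rightarrow> bool" where
  "justified D c \<longleftrightarrow> (let e = fst c; xs = fst (snd c); y = snd (snd c);
       t = fst (prod_decode e); a = snd (prod_decode e);
       f = fst (prod_decode a); g = snd (prod_decode a) in
     t = 0 \<and> y = 0
   \<or> t = 1 \<and> (case xs of [] \<Rightarrow> False | x # xs' \<Rightarrow> xs' = [] \<and> y = Suc x)
   \<or> t = 2 \<and> (case drop a xs of [] \<Rightarrow> False | x # _ \<Rightarrow> y = x)
   \<or> t = 3 \<and> (\<exists>d\<in>set D. fst d = f \<and> snd (snd d) = y \<and>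
        list_all2 (\<lambda>h z. (h, xs, z) \<in> set D) (list_decode g) (fst (snd d)))
   \<or> t = 4 \<and> (case xs of [] \<Rightarrow> False | n # xs' \<Rightarrow>
        if n = 0 then (f, xs', y) \<in> set D
        else (\<exists>d\<in>set D. fst d = e \<and> fst (snd d) = (n - 1) # xs' \<and>
          (g, (n - 1) # snd (snd d) # xs', y) \<in> set D))
   \<or> t = 5 \<and> (a, y # xs, 0) \<in> set D \<and>
        (\<forall>m<y. \<exists>d\<in>set D. fst d = a \<and> fst (snd d) = m # xs \<and> 0 < snd (snd d)))"

fun derivation :: "claim list \<Rightarrow> bool" where
  "derivation [] = True"
| "derivation (c # D) \<longleftrightarrow> justified D c \<and> derivation D"

lemma computable_justified:
  "computable f \<Longrightarrow> computable g \<Longrightarrow> computable (\<lambda>x. justified (f x) (g x))"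
  by (rule computable_fun2) (unfold justified_def Let_def, intro computable_intros)

lemma computable_derivation:
  assumes "computable f" shows "computable (\<lambda>x. derivation (f x))"
proof -
  have "computable (\<lambda>x. fst (foldr (\<lambda>c s. (justified (snd s) c \<and> fst s, c # snd s)) (f x) (True, [])))"
    by (intro computable_intros assms computable_justified)
  moreover have "foldr (\<lambda>c s. (justified (snd s) c \<and> fst s, c # snd s)) D (True, []) = (derivation D, D)" for D
    by (induction D) auto
  ultimately show ?thesis by simp
qed

lemma derivation_sound:
  "derivation D \<Longrightarrow> (prog_code f, xs, y) \<in> set D \<Longrightarrow> computes f xs y"
proof (induction D arbitrary: f xs y)
  case (Cons c D)
  have IH: "(prog_code f, xs, y) \<in> set D \<Longrightarrow> computes f xs y" for f xs y
    using Cons by auto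
  show ?case
  proof (cases "(prog_code f, xs, y) \<in> set D")
    case False
    with Cons.prems have j: "justified D (prog_code f, xs, y)" by auto
    show ?thesis
    proof (cases f)
      case Zero
      with j show ?thesis by (auto simp: justified_def intro: computes.zero)
    next
      case Succ
      with j show ?thesis by (auto simp: justified_def intro: computes.succ split: list.splits)
    next
      case (Proj i)
      with j have "i < length xs \<and> y = xs ! i"
        by (cases "i < length xs") (auto simp: justified_def Cons_nth_drop_Suc[symmetric])
      with Proj show ?thesis by (auto intro: computes.proj)
    next
      case (Comp h gs)
      with j obtain ys where "(prog_code h, ys, y) \<in> set D"
          "list_all2 (\<lambda>c z. (c, xs, z) \<in> set D) (map prog_code gs) ys"
        by (auto simp: justified_def)
      then have "computes h ys y" "list_all2 (\<lambda>g z. computes g xs z) gs ys"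
        by (auto simp: list_all2_map1 intro: IH elim!: list_all2_mono)
      with Comp show ?thesis by (auto intro: computes.comp)
    next
      case (PrimRec g h)
      from j PrimRec obtain n xs' where xs: "xs = n # xs'"
        by (cases xs) (auto simp: justified_def)
      show ?thesis
      proof (cases n)
        case 0
        with j PrimRec xs show ?thesis by (auto simp: justified_def intro: computes.prim_0 IH)
      next
        case (Suc m)
        with j PrimRec xs obtain r where "(prog_code f, m # xs', r) \<in> set D"
            "(prog_code h, m # r # xs', y) \<in> set D"
          by (auto simp: justified_def Let_def)
        then have "computes (PrimRec g h) (m # xs') r" "computes h (m # r # xs') y"
          using IH PrimRec by blast+
        with PrimRec xs Suc show ?thesis by (auto intro: computes.prim_Suc)
      qed
    next
      case (Mu g)
      with j have 1: "(prog_code g, y # xs, 0) \<in> set D"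
        and 2: "\<And>m. m < y \<Longrightarrow> \<exists>z. (prog_code g, m # xs, z) \<in> set D \<and> 0 < z"
        by (auto simp: justified_def Let_def) (metis prod.collapse)
      have "\<exists>k. computes g (m # xs) (Suc k)" if "m < y" for m
        using 2[OF that] IH by (metis gr0_conv_Suc)
      with IH[OF 1] Mu show ?thesis by (auto intro: computes.mu)
    qed
  qed (rule IH)
qed simp

lemma justified_mono:
  "justified D c \<Longrightarrow> set D \<subseteq> set D' \<Longrightarrow> justified D' c"
proof -
  assume s: "set D \<subseteq> set D'"
  have all2: "list_all2 (\<lambda>h z. (h, xs, z) \<in> set D) gs ys \<Longrightarrow> list_all2 (\<lambda>h z. (h, xs, z) \<in> set D') gs ys"
    for xs gs ys using s by (auto elim!: list_all2_mono)
  assume "justified D c"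
  then show "justified D' c"
    unfolding justified_def Let_def
    apply (elim disj_forward conj_forward)
              apply assumption+
    subgoal using s all2 by blast
     apply assumption
    subgoal using s by (auto split: list.splits if_splits)
     apply assumption
    subgoal using s by blast
    subgoal using s by blast
    done
qed

lemma derivation_append:
  "derivation D \<Longrightarrow> derivation D' \<Longrightarrow> derivation (D @ D')"
  by (induction D) (auto elim: justified_mono)

definition derivable :: "claim \<Rightarrow> bool" where
  "derivable c \<longleftrightarrow> (\<exists>D. derivation D \<and> c \<in> set D)"

text \<open>Records can be concatenated, because more entries justify more claims. So a rule of \<open>computes\<close>
  needs only finitely many derivable premises for its conclusion to be derivable.\<close>

lemma derivable_from_finite:
  assumes "finite A" "\<And>a. a \<in> A \<Longrightarrow> derivable a" "\<And>D. A \<subseteq> set D \<Longrightarrow> justified D c"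
  shows "derivable c"
proof -
  have "\<exists>D. derivation D \<and> A \<subseteq> set D"
    using assms(1,2)
  proof (induction A)
    case (insert a A)
    then obtain D where "derivation D" "A \<subseteq> set D" by auto
    moreover obtain D' where "derivation D'" "a \<in> set D'"
      using insert.prems[of a] by (auto simp only: derivable_def insert_iff)
    ultimately
    show ?case by (intro exI[of _ "D @ D'"]) (auto intro: derivation_append)
  qed (auto intro: exI[of _ "[]"])
  then obtain D where "derivation D" "A \<subseteq> set D" by blast
  with assms(3) have "derivation (c # D)" by simp
  then show ?thesis unfolding derivable_def by (meson list.set_intros(1))
qed

lemma computes_derivable: "computes f xs y \<Longrightarrow> derivable (prog_code f, xs, y)"
proof (induction rule: computes.induct)
  case (comp xs gs ys f z)
  show ?case
  proof (rule derivable_from_finite)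
    let ?A = "insert (prog_code f, ys, z) ((\<lambda>(g, y). (prog_code g, xs, y)) ` set (zip gs ys))"
    show "finite ?A" by simp
    show "derivable a" if "a \<in> ?A" for a
    proof -
      have "\<forall>p\<in>set (zip gs ys). derivable (prog_code (fst p), xs, snd p)"
        using comp.IH(1) by (auto simp: list_all2_iff)
      with that comp.IH(2) show ?thesis by auto
    qed
    show "justified D (prog_code (Comp f gs), xs, z)" if "?A \<subseteq> set D" for D
    proof -
      have "list_all2 (\<lambda>h z. (h, xs, z) \<in> set D) (map prog_code gs) ys"
        using that comp(1) by (auto simp: list_all2_iff zip_map1 list_all2_map1)
      with that show ?thesis
        by (auto simp: justified_def intro!: bexI[of _ "(prog_code f, ys, z)"])
    qed
  qed
next
  case (prim_Suc f g n xs r y)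
  let ?c = "(prog_code (PrimRec f g), n # xs, r)"
  show ?case
  proof (rule derivable_from_finite[of "{?c, (prog_code g, n # r # xs, y)}"])
    show "justified D (prog_code (PrimRec f g), Suc n # xs, y)"
      if "{?c, (prog_code g, n # r # xs, y)} \<subseteq> set D" for D
      using that by (auto simp: justified_def Let_def intro!: bexI[of _ ?c])
  qed (use prim_Suc.IH in auto)
next
  case (prim_0 f xs y g)
  show ?case
    by (rule derivable_from_finite[of "{(prog_code f, xs, y)}"])
      (use prim_0.IH in \<open>auto simp: justified_def\<close>)
next
  case (mu f n xs)
  then obtain k where k: "\<And>m. m < n \<Longrightarrow> derivable (prog_code f, m # xs, Suc (k m))"
    by metis
  let ?c = "\<lambda>m. (prog_code f, m # xs, Suc (k m))"
  show ?case
  proof (rule derivable_from_finite)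
    let ?A = "insert (prog_code f, n # xs, 0) (?c ` {..<n})"
    show "finite ?A" by simp
    show "derivable a" if "a \<in> ?A" for a
      using that mu.IH(1) k by auto
    show "justified D (prog_code (Mu f), xs, n)" if "?A \<subseteq> set D" for D
    proof -
      have "\<exists>d\<in>set D. fst d = prog_code f \<and> fst (snd d) = m # xs \<and> 0 < snd (snd d)" if "m < n" for m
        using that \<open>?A \<subseteq> set D\<close> by (intro bexI[of _ "?c m"]) auto
      with that show ?thesis by (simp add: justified_def)
    qed
  qed
next
  case (zero xs)
  have "justified D (prog_code Zero, xs, 0)" for D
    by (simp add: justified_def)
  then show ?case using derivable_from_finite[of "{}"] by simp
next
  case (succ x)
  have "justified D (prog_code Succ, [x], Suc x)" for D
    by (simp add: justified_def)
  then show ?case using derivable_from_finite[of "{}"] by simp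
next
  case (proj i xs)
  then have "justified D (prog_code (Proj i), xs, xs ! i)" for D
    by (simp add: justified_def Cons_nth_drop_Suc[symmetric])
  then show ?case using derivable_from_finite[of "{}"] by simp
qed

theorem computes_iff_derivable:
  "computes f xs y \<longleftrightarrow> (\<exists>D. derivation D \<and> (prog_code f, xs, y) \<in> set D)"
  using computes_derivable derivation_sound unfolding derivable_def by blast

section \<open>The free group\<close>

definition inv_letter :: "'a letter \<Rightarrow> 'a letter" where
  "inv_letter a = (fst a, \<not> snd a)"

definition inv_word :: "'a word \<Rightarrow> 'a word" where
  "inv_word w = rev (map inv_letter w)"

lemma cancels_iff: "cancels a b \<longleftrightarrow> b = inv_letter a"
  by (cases a; cases b) (auto simp: cancels_def inv_letter_def)

lemma inv_letter_inv_letter [simp]: "inv_letter (inv_letter a) = a"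
  by (simp add: inv_letter_def)

lemma inv_word_Nil [simp]: "inv_word [] = []"
  and inv_word_Cons [simp]: "inv_word (a # w) = inv_word w @ [inv_letter a]"
  by (simp_all add: inv_word_def)

lemma fst_set_inv_word [simp]: "fst ` set (inv_word w) = fst ` set w"
  by (auto simp: inv_word_def inv_letter_def image_image)

lemma reduced_Nil [simp]: "reduced []"
  and reduced_ConsD: "reduced (a # w) \<Longrightarrow> reduced w"
  by (cases w; simp add: reduced_def)+

lemma reduced_cons_reduce: "reduced w \<Longrightarrow> reduced (cons_reduce a w)"
  by (cases w) (auto simp: reduced_def successively_Cons)

lemma cons_reduce_reduced: "reduced (a # w) \<Longrightarrow> cons_reduce a w = a # w"
  by (cases w) (auto simp: reduced_def)

lemma cons_reduce_inv_letter:
  "reduced w \<Longrightarrow> cons_reduce a (cons_reduce (inv_letter a) w) = w"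
  by (cases w; cases "tl w") (auto simp: cancels_iff reduced_def)

lemma reduced_foldr: "reduced w \<Longrightarrow> reduced (foldr cons_reduce u w)"
  by (induction u) (auto intro: reduced_cons_reduce)

lemma reduced_reduce: "reduced (reduce w)"
  by (simp add: reduce_def reduced_foldr)

lemma reduce_reduced: "reduced w \<Longrightarrow> reduce w = w"
proof (induction w)
  case (Cons a w)
  then show ?case
    using reduced_ConsD[of a w] cons_reduce_reduced[of a w] by (simp add: reduce_def)
qed (simp add: reduce_def)

lemma reduce_append: "reduce (u @ v) = foldr cons_reduce u (reduce v)"
  by (simp add: reduce_def)

text \<open>Letters act on reduced words by \<open>cons_reduce\<close>, and inverse letters act by inverse bijections.
  Consequently the action of a word is unchanged by reduction, which is the associative law of the
  free group.\<close>

lemma foldr_cons_reduce: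
  "reduced w \<Longrightarrow> foldr cons_reduce (cons_reduce a v) w = cons_reduce a (foldr cons_reduce v w)"
proof (cases v)
  case (Cons b v')
  assume w: "reduced w"
  show ?thesis
  proof (cases "cancels a b")
    case True
    then have "b = inv_letter a" by (simp add: cancels_iff)
    with Cons cons_reduce_inv_letter[OF reduced_foldr[OF w, of v'], of a] True show ?thesis by simp
  qed (simp add: Cons)
qed simp

lemma foldr_reduce:
  "reduced w \<Longrightarrow> foldr cons_reduce (reduce u) w = foldr cons_reduce u w"
  by (induction u) (auto simp: reduce_def foldr_cons_reduce)

lemma reduce_reduce_append: "reduce (reduce u @ v) = reduce (u @ v)"
  by (simp add: reduce_append foldr_reduce reduced_reduce)

lemma reduce_append_reduce: "reduce (u @ reduce v) = reduce (u @ v)"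
  by (simp add: reduce_append reduce_reduced reduced_reduce)

lemma reduce_append_inv_word: "reduce (u @ inv_word u @ v) = reduce v"
proof (induction u arbitrary: v)
  case (Cons a u)
  have "reduce ((a # u) @ inv_word (a # u) @ v) = cons_reduce a (reduce (u @ inv_word u @ inv_letter a # v))"
    by (simp add: reduce_def)
  also have "\<dots> = cons_reduce a (cons_reduce (inv_letter a) (reduce v))"
    unfolding Cons.IH by (simp add: reduce_def)
  also have "\<dots> = reduce v" by (rule cons_reduce_inv_letter[OF reduced_reduce])
  finally show ?case .
qed simp

lemma inv_word_inv_word [simp]: "inv_word (inv_word w) = w"
  by (simp add: inv_word_def rev_map o_def)

lemma letters_cons_reduce: "fst ` set (cons_reduce a w) \<subseteq> insert (fst a) (fst ` set w)"
  by (cases w) auto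

lemma letters_reduce: "fst ` set (reduce w) \<subseteq> fst ` set w"
proof (induction w)
  case (Cons a w)
  have "fst ` set (reduce (a # w)) \<subseteq> insert (fst a) (fst ` set (reduce w))"
    using letters_cons_reduce[of a "reduce w"] by (simp add: reduce_def)
  also have "\<dots> \<subseteq> insert (fst a) (fst ` set w)" using Cons by blast
  finally show ?case by simp
qed (simp add: reduce_def)

lemma carrier_free_group:
  "w \<in> carrier (free_group X) \<longleftrightarrow> fst ` set w \<subseteq> X \<and> reduced w"
  and mult_free_group: "u \<otimes>\<^bsub>free_group X\<^esub> v = reduce (u @ v)"
  and one_free_group: "\<one>\<^bsub>free_group X\<^esub> = []"
  by (simp_all add: free_group_def)

lemma reduce_in_free_group:
  "fst ` set w \<subseteq> X \<Longrightarrow> reduce w \<in> carrier (free_group X)"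
  using order.trans[OF letters_reduce[of w]] by (simp add: carrier_free_group reduced_reduce)

lemma group_free_group: "group (free_group X)"
proof (rule groupI)
  fix u assume u: "u \<in> carrier (free_group X)"
  show "\<exists>v\<in>carrier (free_group X). v \<otimes>\<^bsub>free_group X\<^esub> u = \<one>\<^bsub>free_group X\<^esub>"
  proof
    show "reduce (inv_word u) \<in> carrier (free_group X)"
      using u by (intro reduce_in_free_group) (simp add: carrier_free_group)
    show "reduce (inv_word u) \<otimes>\<^bsub>free_group X\<^esub> u = \<one>\<^bsub>free_group X\<^esub>"
      using reduce_append_inv_word[of "inv_word u" "[]"]
      by (simp add: mult_free_group one_free_group reduce_reduce_append) (simp add: reduce_def)
  qed
next
  fix u v assume "u \<in> carrier (free_group X)" "v \<in> carrier (free_group X)"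
  then show "u \<otimes>\<^bsub>free_group X\<^esub> v \<in> carrier (free_group X)"
    unfolding mult_free_group by (intro reduce_in_free_group) (simp add: carrier_free_group image_Un)
qed (auto simp: mult_free_group one_free_group carrier_free_group reduce_reduce_append
    reduce_append_reduce reduce_reduced)

lemma inv_free_group:
  assumes u: "u \<in> carrier (free_group X)"
  shows "inv\<^bsub>free_group X\<^esub> u = reduce (inv_word u)"
proof (rule group.inv_equality[OF group_free_group])
  show "reduce (inv_word u) \<otimes>\<^bsub>free_group X\<^esub> u = \<one>\<^bsub>free_group X\<^esub>"
    using reduce_append_inv_word[of "inv_word u" "[]"]
    by (simp add: mult_free_group one_free_group reduce_reduce_append) (simp add: reduce_def)
  show "reduce (inv_word u) \<in> carrier (free_group X)"
    using u by (intro reduce_in_free_group) (simp add: carrier_free_group)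
qed (fact u)

section \<open>The action of the free group on functionals\<close>

text \<open>A functional is given by its values on monomials, which are lists of letters below \<open>3\<close>, and is
  extended linearly to noncommutative polynomials over the field with two elements. The elements of
  \<open>functionals n\<close> vanish on the ideal \<open>M\<^sup>n\<close> that is spanned by the monomials of length at least \<open>n\<close>.

  A word \<open>w\<close> acts on functionals by multiplication with its Magnus image:
  \<open>word_act N w \<phi> m\<close> is \<open>\<phi> (\<mu> w * m)\<close>, where \<open>\<mu> x\<^sub>i = 1 + x\<^sub>i\<close>. The inverse of \<open>1 + x\<^sub>i\<close> is the series
  \<open>1 + x\<^sub>i + x\<^sub>i\<^sup>2 + \<dots>\<close>; on \<open>functionals N\<close> it may be cut off at \<open>x\<^sub>i\<^sup>N\<close>. The bound \<open>N\<close>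
  stays fixed while \<open>n \<le> N\<close> varies.\<close>

text \<open>Sums of bits are to be handled as in any abelian group.\<close>

declare add_bit_eq_xor [simp del]

type_synonym functional = "nat list \<Rightarrow> bit"

definition functionals :: "nat \<Rightarrow> functional set" where
  "functionals n = {\<phi>. \<forall>m. \<phi> m \<noteq> 0 \<longrightarrow> length m < n \<and> set m \<subseteq> {..<3}}"

definition left_shift :: "nat list \<Rightarrow> functional \<Rightarrow> functional" where
  "left_shift a \<phi> = (\<lambda>m. \<phi> (a @ m))"

definition right_shift :: "nat list \<Rightarrow> functional \<Rightarrow> functional" where
  "right_shift b \<phi> = (\<lambda>m. \<phi> (m @ b))"

definition delta :: "nat list \<Rightarrow> functional" where
  "delta m = (\<lambda>b. of_bool (b = m))"

definition letter_act :: "nat \<Rightarrow> nat letter \<Rightarrow> functional \<Rightarrow> functional" where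
  "letter_act N a \<phi> = (\<lambda>m. if snd a then \<Sum>k<N. \<phi> (replicate k (fst a) @ m) else \<phi> m + \<phi> (fst a # m))"

definition word_act :: "nat \<Rightarrow> nat word \<Rightarrow> functional \<Rightarrow> functional" where
  "word_act N w = fold (letter_act N) w"

lemma functional_add_self [simp]: "\<phi> + \<phi> = (0 :: functional)"
  by (rule ext) (simp add: plus_fun_def)

lemma functional_add_cancel [simp]: "\<phi> + \<psi> + \<psi> = (\<phi> :: functional)"
  by (simp only: add.assoc functional_add_self add_0_right)

lemma functional_add_cancel_left [simp]: "\<psi> + (\<psi> + \<phi>) = (\<phi> :: functional)"
  by (simp only: add.assoc[symmetric] functional_add_self add_0_left)

text \<open>Characteristic two allows terms to change sides.\<close>

lemma functional_add_exchange:
  assumes "\<alpha> + \<phi> = \<beta> + \<psi>" shows "\<alpha> + \<beta> = \<phi> + (\<psi> :: functional)"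
proof
  fix m
  show "(\<alpha> + \<beta>) m = (\<phi> + \<psi>) m"
    using fun_cong[OF assms, of m] unfolding plus_fun_def
    by (cases "\<alpha> m"; cases "\<beta> m"; cases "\<phi> m"; cases "\<psi> m") simp_all
qed

lemma left_shift_Nil [simp]: "left_shift [] \<phi> = \<phi>"
  and left_shift_left_shift: "left_shift b (left_shift a \<phi>) = left_shift (a @ b) \<phi>"
  and left_shift_add: "left_shift a (\<phi> + \<psi>) = left_shift a \<phi> + left_shift a \<psi>"
  and left_shift_zero [simp]: "left_shift a 0 = 0"
  by (simp_all add: left_shift_def plus_fun_def zero_fun_def)

lemma functionals_0 [simp]: "functionals 0 = {0}"
  by (auto simp: functionals_def zero_fun_def fun_eq_iff)

lemma functionals_zero: "0 \<in> functionals n"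
  by (auto simp: functionals_def)

lemma functionals_add:
  "\<phi> \<in> functionals n \<Longrightarrow> \<psi> \<in> functionals n \<Longrightarrow> \<phi> + \<psi> \<in> functionals n"
proof -
  have "\<phi> m \<noteq> 0 \<or> \<psi> m \<noteq> 0" if "(\<phi> + \<psi>) m \<noteq> 0" for m
    using that by (cases "\<phi> m") (simp_all add: plus_fun_def)
  then show "\<phi> \<in> functionals n \<Longrightarrow> \<psi> \<in> functionals n \<Longrightarrow> \<phi> + \<psi> \<in> functionals n" unfolding functionals_def by blast
qed

lemma functionals_mono:
  "m \<le> n \<Longrightarrow> \<phi> \<in> functionals m \<Longrightarrow> \<phi> \<in> functionals n"
  unfolding functionals_def by force

lemma functionals_support:
  "\<phi> \<in> functionals n \<Longrightarrow> \<phi> m \<noteq> 0 \<Longrightarrow> length m < n \<and> set m \<subseteq> {..<3}"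
  unfolding functionals_def by blast

lemma functionals_left_shift:
  "\<phi> \<in> functionals n \<Longrightarrow> left_shift a \<phi> \<in> functionals (n - length a)"
  using functionals_support[of \<phi> n "a @ _"] unfolding functionals_def left_shift_def by (auto simp: less_diff_conv add.commute)

lemma functionals_left_shift':
  "\<phi> \<in> functionals n \<Longrightarrow> left_shift a \<phi> \<in> functionals n"
  using functionals_left_shift functionals_mono diff_le_self by blast

lemma functionals_right_shift:
  "\<phi> \<in> functionals n \<Longrightarrow> right_shift b \<phi> \<in> functionals (n - length b)"
  using functionals_support[of \<phi> n "_ @ b"] unfolding functionals_def right_shift_def by (auto simp: less_diff_conv)

lemma finite_monomials: "finite {m :: nat list. length m < n \<and> set m \<subseteq> {..<3}}"
  by (rule finite_subset[OF _ finite_lists_length_le[of "{..<3}" n]]) auto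

lemma finite_functionals: "finite (functionals n)"
proof (rule finite_subset)
  let ?M = "{m :: nat list. length m < n \<and> set m \<subseteq> {..<3}}"
  show "functionals n \<subseteq> (\<lambda>S m. of_bool (m \<in> S)) ` Pow ?M"
  proof
    fix \<phi> assume "\<phi> \<in> functionals n"
    moreover have "\<phi> = (\<lambda>m. of_bool (m \<in> {m. \<phi> m \<noteq> 0}))" by (auto simp: fun_eq_iff)
    ultimately show "\<phi> \<in> (\<lambda>S m. of_bool (m \<in> S)) ` Pow ?M" unfolding functionals_def by blast
  qed
qed (simp add: finite_monomials)

text \<open>The functionals \<open>delta m\<close>, dual to the monomials, form a basis.\<close>

lemma functionals_induct:
  assumes "\<phi> \<in> functionals n" "P 0" "\<And>\<phi> \<psi>. P \<phi> \<Longrightarrow> P \<psi> \<Longrightarrow> P (\<phi> + \<psi>)"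
    "\<And>m. length m < n \<Longrightarrow> set m \<subseteq> {..<3} \<Longrightarrow> P (delta m)"
  shows "P \<phi>"
proof -
  let ?M = "{m :: nat list. length m < n \<and> set m \<subseteq> {..<3}}"
  let ?S = "{m. \<phi> m \<noteq> 0}"
  have S: "?S \<subseteq> ?M" using assms(1) by (auto simp: functionals_def)
  have "P (\<lambda>m. of_bool (m \<in> S))" if "finite S" "S \<subseteq> ?M" for S
    using that
  proof (induction S)
    case empty
    then show ?case using assms(2) by (simp add: zero_fun_def)
  next
    case (insert m S)
    have "(\<lambda>b. of_bool (b \<in> insert m S)) = delta m + (\<lambda>b. of_bool (b \<in> S))"
      using insert.hyps(2) by (auto simp: delta_def plus_fun_def fun_eq_iff)
    with insert assms(3,4) show ?case by simp
  qed
  from this[OF finite_subset[OF S finite_monomials] S]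
  have "P (\<lambda>m. of_bool (\<phi> m \<noteq> 0))" by simp
  moreover have "(\<lambda>m. of_bool (\<phi> m \<noteq> 0)) = \<phi>" by (auto simp: fun_eq_iff)
  ultimately show ?thesis by simp
qed

lemma word_act_Nil [simp]: "word_act N [] \<phi> = \<phi>"
  and word_act_Cons [simp]: "word_act N (a # w) \<phi> = word_act N w (letter_act N a \<phi>)"
  and word_act_append: "word_act N (u @ v) \<phi> = word_act N v (word_act N u \<phi>)"
  by (simp_all add: word_act_def)

lemma letter_act_add:
  "letter_act N a (\<phi> + \<psi>) = letter_act N a \<phi> + letter_act N a \<psi>"
  by (rule ext) (simp add: letter_act_def sum.distrib add_ac)

lemma word_act_add: "word_act N w (\<phi> + \<psi>) = word_act N w \<phi> + word_act N w \<psi>"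
  by (induction w arbitrary: \<phi> \<psi>) (simp_all add: letter_act_add)

lemma word_act_zero [simp]: "word_act N w 0 = 0"
  using word_act_add[of N w 0 0] by simp

text \<open>Multiplication from the left commutes with multiplication from the right.\<close>

lemma word_act_right_shift:
  "word_act N w (right_shift b \<phi>) = right_shift b (word_act N w \<phi>)"
proof (induction w arbitrary: \<phi>)
  case (Cons a w)
  have "letter_act N a (right_shift b \<phi>) = right_shift b (letter_act N a \<phi>)"
    by (auto simp: letter_act_def right_shift_def fun_eq_iff)
  with Cons show ?case by simp
qed simp

lemma letter_act_functionals:
  "\<phi> \<in> functionals n \<Longrightarrow> letter_act N a \<phi> \<in> functionals n"
proof -
  assume \<phi>: "\<phi> \<in> functionals n"
  have "length m < n \<and> set m \<subseteq> {..<3}" if "letter_act N a \<phi> m \<noteq> 0" for m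
  proof -
    have "\<exists>b. \<phi> (b @ m) \<noteq> 0"
    proof (rule ccontr)
      assume "\<nexists>b. \<phi> (b @ m) \<noteq> 0"
      then have z: "\<phi> (b @ m) = 0" for b by simp
      from that z z[of "[]"] z[of "[fst a]"] show False by (auto simp: letter_act_def split: if_splits)
    qed
    then obtain b where "\<phi> (b @ m) \<noteq> 0" by blast
    from functionals_support[OF \<phi> this] show ?thesis by simp
  qed
  then show ?thesis by (auto simp: functionals_def)
qed

lemma word_act_functionals:
  "\<phi> \<in> functionals n \<Longrightarrow> word_act N w \<phi> \<in> functionals n"
  by (induction w arbitrary: \<phi>) (auto intro: letter_act_functionals)

lemma sum_telescope_bit: "(\<Sum>k<N. f k + f (Suc k)) = f 0 + (f N :: bit)"
proof (induction N)
  case 0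
  show ?case by (cases "f 0") simp_all
next
  case (Suc N)
  have "f 0 + f N + (f N + f (Suc N)) = f 0 + f (Suc N)"
    by (cases "f 0"; cases "f N"; cases "f (Suc N)") simp_all
  with Suc show ?case by (simp only: sum.lessThan_Suc)
qed

text \<open>The product of \<open>1 + x\<close> and \<open>1 + x + \<dots> + x\<^sup>N\<^sup>-\<^sup>1\<close> telescopes to \<open>1 + x\<^sup>N\<close>, and multiples of \<open>x\<^sup>N\<close> are
  annihilated by all elements of \<open>functionals N\<close>.\<close>

lemma letter_act_inv_letter:
  assumes "\<phi> \<in> functionals N" shows "letter_act N (inv_letter a) (letter_act N a \<phi>) = \<phi>"
proof
  fix m
  let ?f = "\<lambda>k. \<phi> (replicate k (fst a) @ m)"
  have "?f N = 0" using functionals_support[OF assms, of "replicate N (fst a) @ m"] by (cases "?f N") simp_all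
  then have "(\<Sum>k<N. ?f k + ?f (Suc k)) = \<phi> m" using sum_telescope_bit[of ?f N] by simp
  moreover have "letter_act N (inv_letter a) (letter_act N a \<phi>) m = (\<Sum>k<N. ?f k + ?f (Suc k))"
    by (cases "snd a") (simp_all only: letter_act_def inv_letter_def fst_conv snd_conv if_True if_False
        not_True_eq_False not_False_eq_True sum.distrib replicate_app_Cons_same replicate_Suc append_Cons)
  ultimately show "letter_act N (inv_letter a) (letter_act N a \<phi>) m = \<phi> m" by simp
qed

lemma word_act_cons_reduce:
  assumes "\<phi> \<in> functionals N" shows "word_act N (cons_reduce a w) \<phi> = word_act N (a # w) \<phi>"
  using letter_act_inv_letter[OF assms] by (cases w) (auto simp: cancels_iff)

lemma word_act_reduce:
  "\<phi> \<in> functionals N \<Longrightarrow> word_act N (reduce w) \<phi> = word_act N w \<phi>"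
proof (induction w arbitrary: \<phi>)
  case (Cons a w)
  have "word_act N (reduce (a # w)) \<phi> = word_act N (reduce w) (letter_act N a \<phi>)"
    using word_act_cons_reduce[OF Cons.prems] by (simp add: reduce_def)
  with Cons letter_act_functionals show ?case by simp
qed (simp add: reduce_def)

lemma word_act_inv_word:
  "\<phi> \<in> functionals N \<Longrightarrow> word_act N (inv_word w) (word_act N w \<phi>) = \<phi>"
proof (induction w arbitrary: \<phi>)
  case (Cons a w)
  then have "word_act N (inv_word w) (word_act N w (letter_act N a \<phi>)) = letter_act N a \<phi>" by (simp add: letter_act_functionals)
  with Cons.prems show ?case by (simp add: word_act_append letter_act_inv_letter)
qed simp

section \<open>Magnus coefficients\<close>

text \<open>The coefficient of the monomial \<open>m\<close> in \<open>\<mu> w\<close>. For an inverse letter, the recursion comes from the equation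
  \<open>y = \<mu> w + x * y\<close>, which is satisfied by \<open>y = (1 + x)\<^sup>-\<^sup>1 * \<mu> w\<close>.\<close>

fun magnus_coef :: "nat word \<Rightarrow> nat list \<Rightarrow> bool" where
  "magnus_coef [] m \<longleftrightarrow> m = []"
| "magnus_coef (a # w) [] \<longleftrightarrow> True"
| "magnus_coef (a # w) (j # m) \<longleftrightarrow>
     magnus_coef w (j # m) \<noteq> (fst a = j \<and> (if snd a then magnus_coef (a # w) m else magnus_coef w m))"

lemma letter_act_delta_Nil: "0 < N \<Longrightarrow> letter_act N a (delta []) = delta []"
proof
  fix b assume "0 < N"
  then obtain N' where N: "N = Suc N'" by (cases N) auto
  have "delta [] (replicate (Suc k) i @ b) = 0" for k i
    by (simp add: delta_def)
  then have "(\<Sum>k<N. delta [] (replicate k i @ b)) = delta [] b" for i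
    unfolding N sum.lessThan_Suc_shift by (simp only: sum.neutral_const replicate_0 append_Nil add_0_right)
  then show "letter_act N a (delta []) b = delta [] b"
    by (simp add: letter_act_def) (simp add: delta_def)
qed

lemma letter_act_delta_Cons:
  assumes "length (j # m) < N"
  shows "letter_act N a (delta (j # m)) =
    delta (j # m) + (if fst a = j then if snd a then letter_act N a (delta m) else delta m else 0)"
proof
  fix b
  let ?i = "fst a"
  obtain N' where N: "N = Suc N'" "length m < N'" using assms by (cases N) auto
  have Cons: "delta (j # m) (?i # b) = (if ?i = j then delta m b else 0)" for b
    by (simp add: delta_def)
  have "delta m (replicate N' ?i @ b) = 0"
    using N(2) by (auto simp: delta_def)
  then have "(\<Sum>k<N. delta m (replicate k ?i @ b)) = (\<Sum>k<N'. delta m (replicate k ?i @ b))"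
    by (simp only: N sum.lessThan_Suc add_0_right)
  moreover have "(\<Sum>k<N. delta (j # m) (replicate k ?i @ b)) =
      delta (j # m) b + (\<Sum>k<N'. delta (j # m) (?i # replicate k ?i @ b))"
    by (simp only: N sum.lessThan_Suc_shift replicate_Suc append_Cons replicate_0 append_Nil)
  ultimately have "(\<Sum>k<N. delta (j # m) (replicate k ?i @ b)) =
      delta (j # m) b + (if ?i = j then \<Sum>k<N. delta m (replicate k ?i @ b) else 0)"
    by (simp only: Cons) (cases "?i = j"; simp only: simp_thms if_True if_False sum.neutral_const)
  moreover have "delta (j # m) (j # b) = delta m b" by (simp add: delta_def)
  ultimately show "letter_act N a (delta (j # m)) b = (delta (j # m) +
      (if ?i = j then if snd a then letter_act N a (delta m) else delta m else 0)) b"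
    by (cases "snd a"; cases "?i = j") (simp_all only: letter_act_def plus_fun_def zero_fun_def Cons simp_thms if_True if_False)
qed

lemma magnus_coef_Nil_right: "magnus_coef w []"
  by (cases w) auto

lemma word_act_delta:
  "length m < N \<Longrightarrow> word_act N w (delta m) [] = of_bool (magnus_coef w m)"
proof (induction w m rule: magnus_coef.induct)
  case (2 a w)
  have "word_act N w (delta []) = delta []" for w
    using 2 by (induction w) (auto simp: letter_act_delta_Nil)
  then show ?case by (simp only: word_act_Cons letter_act_delta_Nil[OF 2[unfolded list.size]]) (simp add: delta_def)
next
  case (3 a w j m)
  have "word_act N (a # w) (delta (j # m)) [] = word_act N w (delta (j # m)) [] +
    (if fst a = j then if snd a then word_act N (a # w) (delta m) [] else word_act N w (delta m) [] else 0)"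
    by (simp only: word_act_Cons letter_act_delta_Cons[OF 3(4)] word_act_add) (simp add: plus_fun_def)
  with 3 show ?case by auto
qed (simp add: delta_def)

text \<open>For words in the three letters below \<open>3\<close>, this is the congruence of \<open>\<mu> u\<close> and \<open>\<mu> v\<close> modulo \<open>M\<^sup>k\<close>.\<close>

definition agree :: "nat \<Rightarrow> nat word \<Rightarrow> nat word \<Rightarrow> bool" where
  "agree k u v \<longleftrightarrow> (\<forall>m. length m < k \<longrightarrow> set m \<subseteq> {..<3} \<longrightarrow> magnus_coef u m = magnus_coef v m)"

lemma agree_word_act:
  assumes "agree k u v" "\<chi> \<in> functionals k" "\<chi> \<in> functionals N"
  shows "word_act N u \<chi> [] = word_act N v \<chi> []"
proof -
  have "\<chi> \<in> functionals (min k N)" using assms(2,3) by (auto simp: min_def)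
  then show ?thesis
  proof (rule functionals_induct[where P = "\<lambda>\<chi>. word_act N u \<chi> [] = word_act N v \<chi> []"])
    show "word_act N u (delta m) [] = word_act N v (delta m) []" if "length m < min k N" "set m \<subseteq> {..<3}" for m
      using assms(1) that by (simp add: word_act_delta agree_def)
  qed (simp_all only: word_act_add word_act_zero plus_fun_apply)
qed

text \<open>The condition \<open>\<mu> r - 1 \<in> M\<^sup>k\<close>, up to degree \<open>N\<close> and in terms of functionals: multiplication by \<open>\<mu> r - 1\<close> raises
  degrees by \<open>k\<close>, so its transpose lowers them by \<open>k\<close>.\<close>

definition deep :: "nat \<Rightarrow> nat \<Rightarrow> nat word \<Rightarrow> bool" where
  "deep N k r \<longleftrightarrow> (\<forall>n\<le>N. \<forall>\<phi>\<in>functionals n. word_act N r \<phi> + \<phi> \<in> functionals (n - k))"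

lemma deep_Nil: "deep N k []"
  by (auto simp: deep_def simp del: plus_fun_apply intro: functionals_zero)

text \<open>The value of \<open>(\<mu> u - \<mu> v) \<phi>\<close> at a monomial \<open>b\<close> is the value of \<open>\<mu> u - \<mu> v\<close> under the right shift of \<open>\<phi>\<close> by
  \<open>b\<close>. If \<open>b\<close> has length at least \<open>n - k\<close>, this shift lies in \<open>functionals k\<close>, where \<open>u\<close> and \<open>v\<close> cannot
  be told apart. Multiplication with the inverse of \<open>\<mu> v\<close> then preserves degrees.\<close>

lemma agree_deep:
  assumes "agree k u v" shows "deep N k (reduce (u @ inv_word v))"
  unfolding deep_def
proof (intro allI impI ballI)
  fix n \<phi> assume n: "n \<le> N" and \<phi>: "\<phi> \<in> functionals n"
  then have \<phi>N: "\<phi> \<in> functionals N" using functionals_mono by blast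
  let ?\<chi> = "word_act N u \<phi> + word_act N v \<phi>"
  have "?\<chi> \<in> functionals n" using \<phi> by (intro functionals_add word_act_functionals)
  moreover have "?\<chi> b = 0" if "\<not> length b < n - k" for b
  proof -
    have "right_shift b \<phi> \<in> functionals (n - length b)" using \<phi> by (rule functionals_right_shift)
    then have "right_shift b \<phi> \<in> functionals k" "right_shift b \<phi> \<in> functionals N"
      using that n by (auto intro: functionals_mono[rotated])
    from agree_word_act[OF assms this] have "word_act N u \<phi> b = word_act N v \<phi> b"
      by (simp add: word_act_right_shift) (simp add: right_shift_def)
    then show ?thesis by (simp add: plus_fun_def)
  qed
  ultimately have "?\<chi> \<in> functionals (n - k)" unfolding functionals_def by blast
  then have "word_act N (inv_word v) ?\<chi> \<in> functionals (n - k)" by (rule word_act_functionals)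
  with \<phi>N show "word_act N (reduce (u @ inv_word v)) \<phi> + \<phi> \<in> functionals (n - k)"
    by (simp add: word_act_reduce word_act_append word_act_add word_act_inv_word)
qed

section \<open>The Golod--Shafarevich inequality\<close>

text \<open>The functionals on which the two-sided ideal generated by all \<open>\<mu> (r j) - 1\<close> vanishes. Multiples from
  the left are covered by the shifts \<open>left_shift a\<close>, multiples from the right because the equation is one between
  functionals.\<close>

definition invariants :: "nat \<Rightarrow> (nat \<Rightarrow> nat word) \<Rightarrow> functional set" where
  "invariants N r = {\<chi> \<in> functionals N. \<forall>a j. word_act N (r j) (left_shift a \<chi>) = left_shift a \<chi>}"

lemma invariants_zero: "0 \<in> invariants N r"
  by (simp add: invariants_def functionals_zero)

lemma invariants_add:
  "\<phi> \<in> invariants N r \<Longrightarrow> \<psi> \<in> invariants N r \<Longrightarrow> \<phi> + \<psi> \<in> invariants N r"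
  by (simp add: invariants_def functionals_add left_shift_add word_act_add)

lemma invariants_sum:
  "finite K \<Longrightarrow> (\<And>k. k \<in> K \<Longrightarrow> f k \<in> invariants N r) \<Longrightarrow>
    (\<lambda>m. \<Sum>k\<in>K. f k m) \<in> invariants N r"
proof (induction K rule: finite_induct)
  case empty
  then show ?case using invariants_zero by (simp add: zero_fun_def)
next
  case (insert k K)
  then have "f k + (\<lambda>m. \<Sum>k\<in>K. f k m) \<in> invariants N r" by (intro invariants_add) auto
  moreover have "(\<lambda>m. \<Sum>k\<in>insert k K. f k m) = f k + (\<lambda>m. \<Sum>k\<in>K. f k m)"
    using insert.hyps by (simp only: fun_eq_iff sum.insert plus_fun_apply) simp
  ultimately show ?case by simp
qed

lemma invariants_left_shift:
  "\<phi> \<in> invariants N r \<Longrightarrow> left_shift a \<phi> \<in> invariants N r"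
  by (simp add: invariants_def functionals_left_shift' left_shift_left_shift)

lemma letter_act_as_left_shift:
  "letter_act N a \<phi> = (if snd a then (\<lambda>m. \<Sum>k<N. left_shift (replicate k (fst a)) \<phi> m)
     else \<phi> + left_shift [fst a] \<phi>)"
  by (simp add: letter_act_def left_shift_def plus_fun_def fun_eq_iff)

lemma invariants_letter_act:
  "\<phi> \<in> invariants N r \<Longrightarrow> letter_act N a \<phi> \<in> invariants N r"
  by (auto simp: letter_act_as_left_shift intro: invariants_sum invariants_add invariants_left_shift)

lemma invariants_word_act:
  "\<phi> \<in> invariants N r \<Longrightarrow> word_act N w \<phi> \<in> invariants N r"
  by (induction w arbitrary: \<phi>) (auto intro: invariants_letter_act)

text \<open>Since \<open>\<mu> w - 1\<close> has no constant term, it is a combination of the products \<open>x\<^sub>i * p\<close>. Therefore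
  \<open>(\<mu> w - 1) \<phi>\<close> depends only on the shifts of \<open>\<phi>\<close> by the letters, and it is invariant if these are.\<close>

lemma word_act_almost_trivial:
  assumes "\<phi> \<in> functionals N" and invariants: "\<And>i. left_shift [i] \<phi> \<in> invariants N r"
  shows "word_act N w \<phi> + \<phi> \<in> invariants N r"
proof (induction w)
  case Nil
  show ?case by (simp only: word_act_Nil functional_add_self invariants_zero)
next
  case (Cons a w)
  have "letter_act N a \<phi> + \<phi> \<in> invariants N r"
  proof (cases "snd a \<and> 0 < N")
    case True
    then obtain N' where N: "N = Suc N'" by (cases N) auto
    have "left_shift (replicate (Suc k) (fst a)) \<phi> \<in> invariants N r" for k
      using invariants_left_shift[OF invariants[of "fst a"], of "replicate k (fst a)"] by (simp add: left_shift_left_shift)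
    then have "(\<lambda>m. \<Sum>k<N'. left_shift (replicate (Suc k) (fst a)) \<phi> m) \<in> invariants N r" by (intro invariants_sum) auto
    moreover have "letter_act N a \<phi> = \<phi> + (\<lambda>m. \<Sum>k<N'. left_shift (replicate (Suc k) (fst a)) \<phi> m)"
      using True unfolding letter_act_as_left_shift N sum.lessThan_Suc_shift by (simp add: plus_fun_def)
    ultimately show ?thesis by (simp add: add.commute)
  next
    case False
    show ?thesis
    proof (cases "N = 0")
      case True
      with assms(1) have "\<phi> = 0" by simp
      moreover have "letter_act 0 a 0 = 0" by (rule ext) (simp add: letter_act_def)
      ultimately show ?thesis using invariants_zero \<open>N = 0\<close> by (simp only: add_0_right)
    next
      case N: False
      with False invariants[of "fst a"] show ?thesis by (simp add: letter_act_as_left_shift add.commute)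
    qed
  qed
  then have "word_act N w (letter_act N a \<phi> + \<phi>) + (word_act N w \<phi> + \<phi>) \<in> invariants N r"
    by (intro invariants_add[OF _ Cons.IH] invariants_word_act)
  then show ?case by (simp only: word_act_Cons word_act_add add.assoc functional_add_cancel_left)
qed

lemma card_le_card_times_fibre:
  assumes "finite Q" "h ` P \<subseteq> Q" "\<And>q. q \<in> Q \<Longrightarrow> card {p \<in> P. h p = q} \<le> k"
  shows "card P \<le> card Q * k"
proof -
  have "P = (\<Union>q\<in>Q. {p \<in> P. h p = q})" using assms(2) by auto
  then have "card P \<le> (\<Sum>q\<in>Q. card {p \<in> P. h p = q})" using card_UN_le[OF assms(1)] by metis
  also have "\<dots> \<le> card Q * k" using sum_bounded_above[OF assms(3)] by simp
  finally show ?thesis .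
qed

text \<open>The functional with prescribed value at the empty monomial and prescribed shifts by the letters.\<close>

definition assemble :: "bit \<times> (nat \<Rightarrow> functional) \<Rightarrow> functional" where
  "assemble p = (\<lambda>m. case m of [] \<Rightarrow> fst p | i # m' \<Rightarrow> if i < 3 then snd p i m' else 0)"

text \<open>Let \<open>P\<close> be the set of functionals in \<open>functionals (Suc n)\<close> whose shifts by the letters are invariant. Such a
  functional amounts to a value at the empty monomial and three elements of
  \<open>invariants N r \<inter> functionals n\<close>, which explains the left-hand side. It is itself invariant if and only if
  the functionals \<open>(\<mu> (r j) - 1) \<phi>\<close> all vanish. The latter are invariant, and they belong to
  \<open>functionals (n - Suc j)\<close> by depth, so there are at most as many families of them as the product says. Functionals
  in \<open>P\<close> with the same family differ by an element of \<open>invariants N r \<inter> functionals (Suc n)\<close>.\<close>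

lemma golod_shafarevich:
  assumes deep: "\<And>j. deep N (j + 2) (r j)" and n: "Suc n \<le> N"
  shows "2 * card (invariants N r \<inter> functionals n) ^ 3 \<le>
    (\<Prod>j<n. card (invariants N r \<inter> functionals j)) * card (invariants N r \<inter> functionals (Suc n))"
proof -
  let ?invariants = "invariants N r"
  define P where "P = {\<phi> \<in> functionals (Suc n). \<forall>i. left_shift [i] \<phi> \<in> ?invariants}"
  have PV: "P \<subseteq> functionals N" using functionals_mono[OF n] by (auto simp: P_def)
  have "finite P" unfolding P_def using finite_functionals by (rule finite_subset[rotated]) auto
  have "2 * card (?invariants \<inter> functionals n) ^ 3 =
    card (UNIV \<times> ({..<3} \<rightarrow>\<^sub>E ?invariants \<inter> functionals n) :: (bit \<times> (nat \<Rightarrow> functional)) set)"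
  proof -
    have "(UNIV :: bit set) = {0, 1}" by auto
    then have "card (UNIV :: bit set) = card {0, 1 :: bit}" by (rule arg_cong)
    then have "card (UNIV :: bit set) = 2" by simp
    then show ?thesis by (simp add: card_cartesian_product card_PiE)
  qed
  also have "\<dots> \<le> card P"
  proof (rule card_inj_on_le[of assemble])
    show "inj_on assemble (UNIV \<times> ({..<3} \<rightarrow>\<^sub>E ?invariants \<inter> functionals n))"
    proof (rule inj_onI, clarify)
      fix c d :: bit and f g :: "nat \<Rightarrow> functional"
      assume fg: "f \<in> {..<3} \<rightarrow>\<^sub>E ?invariants \<inter> functionals n" "g \<in> {..<3} \<rightarrow>\<^sub>E ?invariants \<inter> functionals n"
        and eq: "assemble (c, f) = assemble (d, g)"
      have "c = d" using fun_cong[OF eq, of "[]"] by (simp add: assemble_def)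
      moreover have "f i = g i" if "i < 3" for i
        using fun_cong[OF eq, of "i # _"] that by (intro ext) (simp add: assemble_def)
      with fg have "f = g" by (intro PiE_ext[of f "{..<3}" _ g]) auto
      ultimately show "c = d \<and> f = g" by simp
    qed
    show "assemble ` (UNIV \<times> ({..<3} \<rightarrow>\<^sub>E ?invariants \<inter> functionals n)) \<subseteq> P"
    proof clarify
      fix c and f :: "nat \<Rightarrow> functional" assume f: "f \<in> {..<3} \<rightarrow>\<^sub>E ?invariants \<inter> functionals n"
      have "assemble (c, f) \<in> functionals (Suc n)"
        using f by (fastforce simp: functionals_def assemble_def PiE_iff split: list.splits if_splits)
      moreover have "left_shift [i] (assemble (c, f)) = (if i < 3 then f i else 0)" for i
        by (auto simp: left_shift_def assemble_def fun_eq_iff)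
      then have "left_shift [i] (assemble (c, f)) \<in> ?invariants" for i
        using f invariants_zero by auto
      ultimately show "assemble (c, f) \<in> P" by (simp add: P_def)
    qed
  qed fact
  also have "\<dots> \<le> card (PiE {..<n} (\<lambda>j. ?invariants \<inter> functionals (n - Suc j))) *
      card (?invariants \<inter> functionals (Suc n))"
  proof (rule card_le_card_times_fibre)
    let ?h = "\<lambda>\<phi>. \<lambda>j\<in>{..<n}. word_act N (r j) \<phi> + \<phi>"
    show "finite (PiE {..<n} (\<lambda>j. ?invariants \<inter> functionals (n - Suc j)))"
      by (intro finite_PiE finite_Int disjI2 finite_functionals) simp
    have deep': "word_act N (r j) \<phi> + \<phi> \<in> functionals (n - Suc j)" if "\<phi> \<in> P" for j \<phi>
      using deep[of j] n that by (force simp: deep_def P_def)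
    show "?h ` P \<subseteq> PiE {..<n} (\<lambda>j. ?invariants \<inter> functionals (n - Suc j))"
      using deep' PV by (auto intro!: word_act_almost_trivial simp: P_def)
    fix q
    let ?F = "{\<phi> \<in> P. ?h \<phi> = q}"
    show "card ?F \<le> card (?invariants \<inter> functionals (Suc n))"
    proof (cases "?F = {}")
      case True
      show ?thesis unfolding True by simp
    next
      case False
      then obtain \<psi> where \<psi>: "\<psi> \<in> P" "?h \<psi> = q" by blast
      show ?thesis
      proof (rule card_inj_on_le[of "\<lambda>\<phi>. \<phi> + \<psi>"])
        show "inj_on (\<lambda>\<phi>. \<phi> + \<psi>) ?F" by (rule inj_onI) (drule arg_cong[of _ _ "\<lambda>\<chi>. \<chi> + \<psi>"], simp)
        show "finite (?invariants \<inter> functionals (Suc n))" by (simp add: finite_functionals)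
        show "(\<lambda>\<phi>. \<phi> + \<psi>) ` ?F \<subseteq> ?invariants \<inter> functionals (Suc n)"
        proof clarify
          fix \<phi> assume \<phi>: "\<phi> \<in> P" "q = ?h \<phi>"
          have "\<phi> + \<psi> \<in> functionals (Suc n)" using \<phi> \<psi> by (auto simp: P_def intro: functionals_add)
          moreover have "word_act N (r j) (left_shift a (\<phi> + \<psi>)) = left_shift a (\<phi> + \<psi>)" for a j
          proof (cases a)
            case Nil
            have "word_act N (r j) \<phi> + \<phi> = word_act N (r j) \<psi> + \<psi>"
            proof (cases "j < n")
              case True
              with \<phi>(2) \<psi>(2) show ?thesis by (metis restrict_apply' lessThan_iff)
            next
              case False
              with deep'[of \<phi> j] deep'[of \<psi> j] \<phi> \<psi> show ?thesis by simp
            qed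
            then have "word_act N (r j) (\<phi> + \<psi>) = \<phi> + \<psi>"
              unfolding word_act_add by (rule functional_add_exchange)
            with Nil show ?thesis by simp
          next
            case (Cons i a')
            have "left_shift [i] \<phi> \<in> ?invariants" "left_shift [i] \<psi> \<in> ?invariants" using \<phi> \<psi> by (auto simp: P_def)
            then have "left_shift [i] (\<phi> + \<psi>) \<in> ?invariants" by (simp add: left_shift_add invariants_add)
            then have "word_act N (r j) (left_shift a' (left_shift [i] (\<phi> + \<psi>))) = left_shift a' (left_shift [i] (\<phi> + \<psi>))"
              by (simp add: invariants_def)
            with Cons show ?thesis by (simp add: left_shift_left_shift)
          qed
          ultimately show "\<phi> + \<psi> \<in> ?invariants \<inter> functionals (Suc n)"
            using functionals_mono[OF n] by (simp add: invariants_def)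
        qed
      qed
    qed
  qed
  also have "card (PiE {..<n} (\<lambda>j. ?invariants \<inter> functionals (n - Suc j))) =
      (\<Prod>j<n. card (?invariants \<inter> functionals j))"
    using prod.nat_diff_reindex[of "\<lambda>j. card (?invariants \<inter> functionals j)" n] by (simp add: card_PiE)
  finally show ?thesis .
qed

text \<open>With \<open>E n\<close> for the number of elements in degree \<open>n\<close>: as long as the product of the
  previous values is at most \<open>E n\<close>, the inequality yields \<open>E (Suc n) \<ge> 2 * (E n)\<^sup>2\<close>, and this preserves the bound on the
  product.\<close>

lemma card_invariants_growth:
  assumes deep: "\<And>j. deep N (j + 2) (r j)"
  shows "n \<le> N \<Longrightarrow>
    (\<Prod>j<n. card (invariants N r \<inter> functionals j)) \<le> card (invariants N r \<inter> functionals n) \<and>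
    2 ^ n \<le> card (invariants N r \<inter> functionals n)"
proof (induction n)
  case 0
  have "invariants N r \<inter> functionals 0 = {0}" using invariants_zero by auto
  then show ?case by simp
next
  case (Suc n)
  define E where "E = (\<lambda>n. card (invariants N r \<inter> functionals n))"
  have IH: "(\<Prod>j<n. E j) \<le> E n" "2 ^ n \<le> E n" using Suc by (auto simp: E_def)
  then have pos: "0 < E n" by (metis less_le_trans zero_less_numeral zero_less_power)
  have "E n * (2 * E n ^ 2) = 2 * E n ^ 3" by (simp add: power2_eq_square power3_eq_cube)
  also have "\<dots> \<le> (\<Prod>j<n. E j) * E (Suc n)"
    using golod_shafarevich[OF deep Suc.prems] by (simp add: E_def)
  also have "\<dots> \<le> E n * E (Suc n)" using IH by simp
  finally have 1: "2 * E n ^ 2 \<le> E (Suc n)" using pos by simp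
  have "(\<Prod>j<Suc n. E j) \<le> E n * E n" using IH by simp
  moreover have "2 ^ Suc n \<le> 2 * E n" "E n \<le> E n * E n" using IH pos by auto
  ultimately have "(\<Prod>j<Suc n. E j) \<le> E (Suc n)" "2 ^ Suc n \<le> E (Suc n)"
    using 1 unfolding power2_eq_square by linarith+
  then show ?case by (simp add: E_def)
qed

lemma card_invariants:
  assumes "\<And>j. deep N (j + 2) (r j)" shows "2 ^ N \<le> card (invariants N r)"
proof -
  have "invariants N r \<inter> functionals N = invariants N r" by (auto simp: invariants_def)
  with card_invariants_growth[OF assms, of N] show ?thesis by simp
qed

section \<open>Groups given by deep relators\<close>

lemma normal_closure_normal:
  assumes "group G" "R \<subseteq> carrier G" shows "normal_closure G R \<lhd> G"
proof -
  interpret group G by fact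
  let ?A = "{N. N \<lhd> G \<and> R \<subseteq> N}"
  have "carrier G \<lhd> G"
    by (rule normal_invI) (auto simp: subgroup_self)
  then have ne: "carrier G \<in> ?A" using assms(2) by simp
  show ?thesis
    unfolding normal_closure_def
  proof (rule normal_invI)
    show "subgroup (\<Inter> ?A) G"
      using ne by (intro subgroups_Inter) (auto intro: normal_imp_subgroup)
    show "x \<otimes>\<^bsub>G\<^esub> h \<otimes>\<^bsub>G\<^esub> inv\<^bsub>G\<^esub> x \<in> \<Inter> ?A" if "x \<in> carrier G" "h \<in> \<Inter> ?A" for x h
      using that by (auto intro: normal.inv_op_closed2)
  qed
qed

lemma normal_closure_superset: "R \<subseteq> normal_closure G R"
  by (auto simp: normal_closure_def)

lemma normal_closure_least:
  "N \<lhd> G \<Longrightarrow> R \<subseteq> N \<Longrightarrow> normal_closure G R \<subseteq> N"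
  by (auto simp: normal_closure_def)

abbreviation F3 :: "nat word monoid" where
  "F3 \<equiv> free_group {..<3}"

lemma stabilizer_normal:
  "{w \<in> carrier F3. \<forall>\<phi>\<in>invariants N r. word_act N w \<phi> = \<phi>} \<lhd> F3" (is "?S \<lhd> _")
proof -
  interpret group F3 by (rule group_free_group)
  have functionals: "\<phi> \<in> functionals N" if "\<phi> \<in> invariants N r" for \<phi> using that by (simp add: invariants_def)
  have mult: "word_act N (u \<otimes>\<^bsub>F3\<^esub> v) \<phi> = word_act N v (word_act N u \<phi>)" if "\<phi> \<in> invariants N r" for u v \<phi>
    using functionals[OF that] by (simp add: mult_free_group word_act_reduce word_act_append)
  have inv: "word_act N (inv\<^bsub>F3\<^esub> u) (word_act N u \<phi>) = \<phi>" if "u \<in> carrier F3" "\<phi> \<in> invariants N r" for u \<phi>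
    using functionals[OF that(2)] that(1) by (simp add: inv_free_group word_act_reduce word_act_functionals word_act_inv_word)
  show ?thesis
  proof (rule normal_invI)
    show "subgroup ?S F3"
    proof (rule subgroupI)
      have "\<one>\<^bsub>F3\<^esub> \<in> ?S" using one_closed by (simp add: one_free_group)
      then show "?S \<noteq> {}" by blast
      show "inv\<^bsub>F3\<^esub> u \<in> ?S" if "u \<in> ?S" for u
        using that inv[of u] by auto
      show "u \<otimes>\<^bsub>F3\<^esub> v \<in> ?S" if "u \<in> ?S" "v \<in> ?S" for u v
        using that by (auto simp: mult)
    qed auto
    show "x \<otimes>\<^bsub>F3\<^esub> h \<otimes>\<^bsub>F3\<^esub> inv\<^bsub>F3\<^esub> x \<in> ?S" if "x \<in> carrier F3" "h \<in> ?S" for x h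
      using that by (auto simp: mult inv invariants_word_act)
  qed
qed

text \<open>Invariant functionals are fixed by the relators, and what fixes them is a normal subgroup.\<close>

lemma word_act_coset:
  assumes R: "R \<subseteq> carrier F3" "R \<subseteq> range r" and \<phi>: "\<phi> \<in> invariants N r"
    and w: "w \<in> normal_closure F3 R #>\<^bsub>F3\<^esub> w'"
  shows "word_act N w \<phi> = word_act N w' \<phi>"
proof -
  have "word_act N (r j) \<psi> = \<psi>" if "\<psi> \<in> invariants N r" for j \<psi>
    using that left_shift_Nil[of \<psi>] unfolding invariants_def by (metis (mono_tags, lifting) mem_Collect_eq)
  then have "R \<subseteq> {w \<in> carrier F3. \<forall>\<phi>\<in>invariants N r. word_act N w \<phi> = \<phi>}"
    using R by blast
  then have "normal_closure F3 R \<subseteq> {w \<in> carrier F3. \<forall>\<phi>\<in>invariants N r. word_act N w \<phi> = \<phi>}"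
    by (intro normal_closure_least stabilizer_normal)
  moreover obtain k where "k \<in> normal_closure F3 R" "w = reduce (k @ w')"
    using w by (auto simp: r_coset_def mult_free_group)
  ultimately show ?thesis
    using \<phi> by (auto simp: invariants_def word_act_reduce word_act_append)
qed

text \<open>Because \<open>x\<^sub>i = \<mu> x\<^sub>i - 1\<close>, the Magnus images of words span all polynomials.\<close>

lemma functional_eqI:
  assumes "\<And>w. fst ` set w \<subseteq> {..<3} \<Longrightarrow> word_act N w \<phi> [] = word_act N w \<psi> []"
    "\<phi> \<in> functionals N" "\<psi> \<in> functionals N"
  shows "\<phi> = \<psi>"
proof
  have *: "word_act N w \<phi> m = word_act N w \<psi> m" if "fst ` set w \<subseteq> {..<3}" "set m \<subseteq> {..<3}" for w m
    using that
  proof (induction m arbitrary: w)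
    case Nil
    then show ?case using assms(1) by simp
  next
    case (Cons i m)
    have eq: "word_act N w \<chi> (i # m) = word_act N (w @ [(i, False)]) \<chi> m + word_act N w \<chi> m" for \<chi>
      by (cases "word_act N w \<chi> m"; cases "word_act N w \<chi> (i # m)") (simp_all add: word_act_append letter_act_def)
    from Cons show ?case by (simp add: eq)
  qed
  have "\<phi> m = \<psi> m" if "set m \<subseteq> {..<3}" for m
    using *[of "[]" m] that by simp
  moreover have "\<phi> m = 0 \<and> \<psi> m = 0" if "\<not> set m \<subseteq> {..<3}" for m
    using that functionals_support[OF assms(2), of m] functionals_support[OF assms(3), of m] by blast
  ultimately show "\<phi> m = \<psi> m" for m by metis
qed

text \<open>An invariant functional \<open>\<phi>\<close> gives rise to the function \<open>w \<mapsto> \<phi> (\<mu> w)\<close>, which is well defined on the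
  group and determines \<open>\<phi>\<close>. A group with \<open>k\<close> elements has only \<open>2\<^sup>k\<close> functions into the field with
  two elements, but there are at least \<open>2\<^sup>N\<close> invariant functionals for every \<open>N\<close>.\<close>

theorem infinite_presented_group:
  assumes R: "R \<subseteq> carrier F3" "R \<subseteq> range r" and deep: "\<And>N j. deep N (j + 2) (r j)"
  shows "infinite (carrier (presented_group {..<3} R))"
proof
  let ?G = "presented_group {..<3} R"
  let ?K = "normal_closure F3 R"
  interpret normal ?K F3 by (rule normal_closure_normal[OF group_free_group R(1)])
  assume fin: "finite (carrier ?G)"
  define N where "N = Suc (card (carrier ?G))"
  let ?ev = "\<lambda>\<phi>. \<lambda>C\<in>carrier ?G. word_act N (SOME w. w \<in> C) \<phi> []"
  have "card (invariants N r) \<le> card (carrier ?G \<rightarrow>\<^sub>E (UNIV :: bit set))"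
  proof (rule card_inj_on_le)
    show "inj_on ?ev (invariants N r)"
    proof (rule inj_onI)
      fix \<phi> \<psi> assume \<phi>: "\<phi> \<in> invariants N r" and \<psi>: "\<psi> \<in> invariants N r" and eq: "?ev \<phi> = ?ev \<psi>"
      then have functionals: "\<phi> \<in> functionals N" "\<psi> \<in> functionals N" by (auto simp: invariants_def)
      have "word_act N w \<phi> [] = word_act N w \<psi> []" if w: "fst ` set w \<subseteq> {..<3}" for w
      proof -
        let ?C = "?K #>\<^bsub>F3\<^esub> reduce w"
        have "reduce w \<in> carrier F3" using w by (rule reduce_in_free_group)
        then have C: "?C \<in> carrier ?G" "reduce w \<in> ?C"
          by (auto simp: presented_group_def FactGroup_def RCOSETS_def intro: rcos_self is_subgroup)
        have "(SOME w. w \<in> ?C) \<in> ?C" using C(2) by (rule someI)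
        then have "word_act N w \<chi> = word_act N (SOME w. w \<in> ?C) \<chi>" if "\<chi> \<in> invariants N r" for \<chi>
          using word_act_coset[OF R that] that by (simp add: invariants_def word_act_reduce)
        with fun_cong[OF eq, of ?C] C(1) \<phi> \<psi> show ?thesis by simp
      qed
      with functionals show "\<phi> = \<psi>" by (intro functional_eqI)
    qed
    show "finite (carrier ?G \<rightarrow>\<^sub>E (UNIV :: bit set))"
      using fin by (intro finite_PiE) (auto intro: finite_subset[of _ "{0, 1}"])
  qed auto
  also have "\<dots> = 2 ^ card (carrier ?G)"
  proof -
    have "(UNIV :: bit set) = {0, 1}" by auto
    then have "card (UNIV :: bit set) = card {0, 1 :: bit}" by (rule arg_cong)
    then show ?thesis using fin by (simp add: card_PiE numeral_2_eq_2)
  qed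
  finally have "(2::nat) ^ N \<le> 2 ^ card (carrier ?G)"
    using card_invariants[OF deep, of N] by linarith
  then show False by (simp add: N_def)
qed

text \<open>Relators of depth at least \<open>2\<close> act trivially in degree \<open>1\<close>; so the coefficient of \<open>x\<^sub>i\<close> is a
  function on the group, and it distinguishes the generators.\<close>

lemma generators_distinct:
  assumes R: "R \<subseteq> carrier F3" "R \<subseteq> range r" and deep: "\<And>N j. deep N (j + 2) (r j)"
    and i: "i < 3"
    and eq: "normal_closure F3 R #>\<^bsub>F3\<^esub> [(i, False)] = normal_closure F3 R #>\<^bsub>F3\<^esub> [(j, False)]"
  shows "i = j"
proof -
  interpret normal "normal_closure F3 R" F3 by (rule normal_closure_normal[OF group_free_group R(1)])
  have d: "delta [i] \<in> functionals 2" using i by (auto simp: functionals_def delta_def split: if_splits)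
  have triv: "word_act 2 (r k) \<phi> = \<phi>" if "\<phi> \<in> functionals 2" for k \<phi>
  proof -
    have "word_act 2 (r k) \<phi> + \<phi> = 0" using deep[of 2 k] that unfolding deep_def by force
    then have "word_act 2 (r k) \<phi> + \<phi> + \<phi> = 0 + \<phi>" by (rule arg_cong)
    then show ?thesis by (simp only: functional_add_cancel add_0_left)
  qed
  then have invariants: "delta [i] \<in> invariants 2 r" using d by (auto simp: invariants_def functionals_left_shift')
  have "[(i, False)] \<in> carrier F3" using i by (simp add: carrier_free_group reduced_def)
  then have "[(i, False)] \<in> normal_closure F3 R #>\<^bsub>F3\<^esub> [(j, False)]"
    using eq rcos_self is_subgroup by blast
  from word_act_coset[OF R invariants this] have "letter_act 2 (i, False) (delta [i]) [] = letter_act 2 (j, False) (delta [i]) []"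
    by simp
  then show ?thesis by (simp add: letter_act_def delta_def split: if_splits)
qed

lemma word_value_coset:
  assumes R: "R \<subseteq> carrier (free_group X)" and w: "w \<in> carrier (free_group X)"
  shows "word_value (presented_group X R) (\<lambda>i. normal_closure (free_group X) R #>\<^bsub>free_group X\<^esub> [(i, False)]) w
    = normal_closure (free_group X) R #>\<^bsub>free_group X\<^esub> w"
proof -
  let ?F = "free_group X" and ?G = "presented_group X R"
  let ?K = "normal_closure ?F R"
  let ?x = "\<lambda>i. ?K #>\<^bsub>?F\<^esub> [(i, False)]"
  interpret normal ?K ?F by (rule normal_closure_normal[OF group_free_group R])
  interpret hom: group_hom ?F ?G "\<lambda>a. ?K #>\<^bsub>?F\<^esub> a"
    unfolding presented_group_def
    by (intro group_hom.intro group_hom_axioms.intro group_free_group factorgroup_is_group r_coset_hom_Mod)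
  have letter: "letter_value ?G ?x a = ?K #>\<^bsub>?F\<^esub> [a]" if "fst a \<in> X" for a
  proof -
    have i: "[(fst a, False)] \<in> carrier ?F" using that by (simp add: carrier_free_group reduced_def)
    have "inv\<^bsub>?F\<^esub> [(fst a, False)] = [(fst a, True)]"
      by (simp add: inv_free_group[OF i] inv_letter_def reduce_def)
    with hom.hom_inv[OF i] show ?thesis by (cases a) (auto simp: letter_value_def)
  qed
  show ?thesis
    using w
  proof (induction w)
    case Nil
    then show ?case using hom.hom_one by (simp add: word_value_def one_free_group)
  next
    case (Cons a w)
    then have a: "fst a \<in> X" "[a] \<in> carrier ?F" and w: "w \<in> carrier ?F"
      by (auto simp: carrier_free_group reduced_def[of "[a]"] dest: reduced_ConsD)
    have "a # w = [a] \<otimes>\<^bsub>?F\<^esub> w"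
      using Cons.prems by (simp add: mult_free_group reduce_reduced carrier_free_group)
    then have "?K #>\<^bsub>?F\<^esub> (a # w) = (?K #>\<^bsub>?F\<^esub> [a]) \<otimes>\<^bsub>?G\<^esub> (?K #>\<^bsub>?F\<^esub> w)"
      using hom.hom_mult[OF a(2) w] by simp
    moreover have "word_value ?G ?x (a # w) = letter_value ?G ?x a \<otimes>\<^bsub>?G\<^esub> word_value ?G ?x w"
      by (simp add: word_value_def)
    ultimately show ?case using letter[OF a(1)] Cons.IH[OF w] by simp
  qed
qed

lemma word_value_generate:
  "fst ` set w \<subseteq> I \<Longrightarrow> word_value G x w \<in> generate G (x ` I)"
proof (induction w)
  case Nil
  then show ?case by (simp add: word_value_def generate.one)
next
  case (Cons a w)
  then have "letter_value G x a \<in> generate G (x ` I)"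
    by (auto simp: letter_value_def intro: generate.incl generate.inv)
  with Cons show ?case by (auto simp: word_value_def intro: generate.eng)
qed

section \<open>Computability of the search for relators\<close>

lemma computable_reduce:
  assumes "computable f"
  shows "computable (\<lambda>x. reduce (f x) :: nat word)"
proof -
  have "cons_reduce = (\<lambda>(a :: nat letter) w. case w of [] \<Rightarrow> [a] | b # w' \<Rightarrow>
      if fst a = fst b \<and> snd a \<noteq> snd b then w' else a # b # w')"
    by (intro ext) (simp add: cancels_def split: list.split)
  then have eq: "reduce = (\<lambda>w. foldr (\<lambda>(a :: nat letter) w. case w of [] \<Rightarrow> [a] | b # w' \<Rightarrow>
      if fst a = fst b \<and> snd a \<noteq> snd b then w' else a # b # w') w [])"
    by (intro ext) (simp only: reduce_def)
  show ?thesis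
    unfolding eq by (intro computable_intros assms)
qed

lemma computable_inv_word:
  "computable f \<Longrightarrow> computable (\<lambda>x. inv_word (f x) :: nat word)"
  unfolding inv_word_def inv_letter_def by (intro computable_rev computable_intros)

text \<open>The recursion for \<open>magnus_coef\<close> runs over the word and over the monomial at the same time. It is unfolded into
  two nested folds, for which the coefficients of all suffixes of the monomial are kept in a row.
  Each entry carries the first letter of its suffix, as the next row depends on it.\<close>

fun magnus_coef_row :: "nat word \<Rightarrow> nat list \<Rightarrow> (nat \<times> bool) list" where
  "magnus_coef_row w [] = []"
| "magnus_coef_row w (j # m) = (j, magnus_coef w (j # m)) # magnus_coef_row w m"

text \<open>The row is rewritten from the shortest suffix on. The state consists of the new row, the old
  coefficient and the new coefficient of the suffix reached; both are true for the empty suffix.\<close>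

definition next_row :: "nat letter \<Rightarrow> (nat \<times> bool) list \<Rightarrow> (nat \<times> bool) list \<times> bool \<times> bool" where
  "next_row a row = foldr (\<lambda>p s.
     ((fst p, snd p \<noteq> (fst p = fst a \<and> (if snd a then snd (snd s) else fst (snd s)))) # fst s,
      snd p, snd p \<noteq> (fst p = fst a \<and> (if snd a then snd (snd s) else fst (snd s))))) row ([], True, True)"

lemma next_row:
  "next_row a (magnus_coef_row w m) = (magnus_coef_row (a # w) m, magnus_coef w m, magnus_coef (a # w) m)"
  by (induction m) (auto simp: next_row_def magnus_coef_Nil_right)

lemma magnus_coef_row_foldr:
  "magnus_coef_row w m = foldr (\<lambda>a row. fst (next_row a row)) w (map (\<lambda>j. (j, False)) m)"
proof (induction w)
  case Nil
  show ?case by (induction m) auto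
next
  case (Cons a w)
  then show ?case using next_row[of a w m] by simp
qed

lemma computable_magnus_coef:
  assumes "computable f" "computable g"
  shows "computable (\<lambda>x. magnus_coef (f x) (g x))"
proof -
  have "computable (\<lambda>x. case magnus_coef_row (f x) (g x) of [] \<Rightarrow> True | p # row \<Rightarrow> snd p)"
    unfolding magnus_coef_row_foldr next_row_def by (intro computable_intros assms)
  moreover have "magnus_coef w m = (case magnus_coef_row w m of [] \<Rightarrow> True | p # row \<Rightarrow> snd p)" for w m
    by (cases m) (auto simp: magnus_coef_Nil_right)
  ultimately show ?thesis by simp
qed

definition monomials :: "nat \<Rightarrow> nat list list" where
  "monomials = rec_nat [] (\<lambda>_ ms. [] # concat (map (\<lambda>m. [0 # m, 1 # m, 2 # m]) ms))"

lemma set_monomials: "set (monomials k) = {m. length m < k \<and> set m \<subseteq> {..<3}}"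
proof (induction k)
  case (Suc k)
  have "m \<in> set (monomials (Suc k)) \<longleftrightarrow> length m < Suc k \<and> set m \<subseteq> {..<3}" for m
  proof (cases m)
    case (Cons i m')
    have "m \<in> set (monomials (Suc k)) \<longleftrightarrow> i \<in> {0, 1, 2} \<and> m' \<in> set (monomials k)"
      using Cons by (auto simp: monomials_def)
    then show ?thesis using Cons Suc by auto
  qed (auto simp: monomials_def)
  then show ?case by blast
qed (simp add: monomials_def)

lemma agree_iff:
  "agree k u v \<longleftrightarrow> (\<forall>m\<in>set (monomials k). magnus_coef u m = magnus_coef v m)"
  by (auto simp: agree_def set_monomials)

lemma computable_agree:
  assumes "computable k" "computable f" "computable g" shows "computable (\<lambda>x. agree (k x) (f x) (g x))"
proof -
  have "computable (\<lambda>x. \<forall>m\<in>set (monomials (k x)). magnus_coef (f x) m = magnus_coef (g x) m)"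
    unfolding monomials_def
    by (intro computable_intros computable_magnus_coef assms computable_compose[OF assms(2)] computable_compose[OF assms(3)])
  then show ?thesis by (simp add: agree_iff)
qed

lemma word_code_enc: "word_code w = enc w"
proof -
  have "(\<lambda>(i, s). prod_encode (i, of_bool s)) = (enc :: nat letter \<Rightarrow> nat)"
    by (auto simp: enc_prod_def enc_nat_def enc_bool_def)
  then show ?thesis by (simp add: word_code_def enc_list_def)
qed

definition decode_word :: "nat \<Rightarrow> nat word" where
  "decode_word y = map (\<lambda>c. (fst (prod_decode c), snd (prod_decode c) = 1)) (list_decode y)"

lemma decode_word_enc: "decode_word (enc w) = w"
proof -
  have "(\<lambda>c. (fst (prod_decode c), snd (prod_decode c) = 1)) \<circ> enc = (id :: nat letter \<Rightarrow> _)"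
    by (auto simp: enc_prod_def enc_nat_def enc_bool_def)
  then show ?thesis by (simp add: decode_word_def enc_list_def)
qed

lemma computable_decode_word:
  "computable f \<Longrightarrow> computable (\<lambda>x. decode_word (f x))"
  unfolding decode_word_def by (intro computable_intros)

lemma surj_enc_nat: "surj (enc :: nat \<Rightarrow> nat)"
  by (auto simp: enc_nat_def surj_def)

lemma surj_enc_prod:
  assumes "surj (enc :: 'a::enc \<Rightarrow> nat)" "surj (enc :: 'b::enc \<Rightarrow> nat)"
  shows "surj (enc :: 'a \<times> 'b \<Rightarrow> nat)"
proof (rule surjI)
  show "enc (inv_into UNIV enc (fst (prod_decode n)) :: 'a, inv_into UNIV enc (snd (prod_decode n)) :: 'b) = n" for n
    using assms by (simp add: enc_prod_def f_inv_into_f)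
qed

lemma surj_enc_list:
  assumes "surj (enc :: 'a::enc \<Rightarrow> nat)" shows "surj (enc :: 'a list \<Rightarrow> nat)"
proof (rule surjI)
  show "enc (map (inv_into UNIV enc :: nat \<Rightarrow> 'a) (list_decode n)) = n" for n
    using assms by (simp add: enc_list_def f_inv_into_f o_def)
qed

text \<open>A computable relation with a solution for \<open>e\<close> has one with the least code, and \<open>Mu\<close> finds it. Every
  number has to be the code of a candidate, so that the search never meets a number on which the
  test might diverge.\<close>

lemma computable_choice:
  fixes P :: "nat \<Rightarrow> 'c::enc \<Rightarrow> bool" and out :: "'c \<Rightarrow> 'd::enc"
  assumes P: "computable (\<lambda>p. P (fst p) (snd p))" and out: "computable out" and surj: "surj (enc :: 'c \<Rightarrow> nat)"
  obtains pick f where "\<And>e. \<exists>c. P e c \<Longrightarrow> P e (pick e)"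
    "\<And>e y. computes f [e] y \<longleftrightarrow> (\<exists>c. P e c) \<and> y = enc (out (pick e))"
proof -
  define dec :: "nat \<Rightarrow> 'c" where "dec = inv_into UNIV enc"
  have enc_dec: "enc (dec n) = n" for n using surj by (simp add: dec_def f_inv_into_f)
  have dec_enc: "dec (enc c) = c" for c by (simp add: dec_def inv_into_f_f[OF inj_enc])
  have dec: "computable (\<lambda>x. dec (g x))" if "computable g" for g :: "'e::enc \<Rightarrow> nat"
    by (rule computable_of_code) (simp add: enc_dec that)
  have "computable (\<lambda>p. \<not> P (fst p) (dec (snd p)))"
    by (intro computable_intros computable_fun2[OF P] dec)
  then obtain tP where tP: "\<And>e n. computes tP [prod_encode (e, n)] (of_bool (\<not> P e (dec n)))"
    by (elim computableE) (force simp: enc_prod_def enc_nat_def enc_bool_def)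
  let ?q = "Comp tP [Comp pair_term [Proj 1, Proj 0]]"
  have q: "computes ?q [n, e] (of_bool (\<not> P e (dec n)))" for n e
    by (rule computes_Comp1[OF _ tP], rule computes_Comp2[OF _ _ computes_pair_term])
      (auto intro: computes_Proj)
  have "computable (\<lambda>n. out (dec n))" by (intro computable_compose[OF out] dec computable_id)
  then obtain tout where tout: "\<And>n. computes tout [n] (enc (out (dec n)))"
    unfolding computable_def enc_nat_def by blast
  let ?f = "Comp tout [Mu ?q]"
  define pick where "pick e = dec (LEAST n. P e (dec n))" for e
  have pick: "P e (pick e)" if "\<exists>c. P e c" for e
    using that unfolding pick_def by (metis LeastI dec_enc)
  have halts: "computes ?f [e] (enc (out (pick e)))" if "\<exists>c. P e c" for e
    unfolding pick_def
  proof (rule computes_Comp1[OF _ tout], rule computes.mu)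
    let ?n = "LEAST n. P e (dec n)"
    show "computes ?q [?n, e] 0" using q[of ?n e] pick[OF that] by (simp add: pick_def)
    show "\<forall>m<?n. \<exists>k. computes ?q [m, e] (Suc k)"
      using q[of _ e] not_less_Least[of _ "\<lambda>n. P e (dec n)"] by (metis One_nat_def of_bool_eq(2))
  qed
  have found: "\<exists>c. P e c" if "computes ?f [e] y" for e y
  proof -
    from that obtain n where "computes (Mu ?q) [e] n"
      by (cases rule: computes.cases) (auto simp: list_all2_Cons1)
    then have "computes ?q [n, e] 0" by (cases rule: computes.cases) auto
    from computes_deterministic[OF this q] show ?thesis by (auto split: if_splits)
  qed
  show thesis
  proof (rule that[of pick ?f])
    show "computes ?f [e] y \<longleftrightarrow> (\<exists>c. P e c) \<and> y = enc (out (pick e))" for e y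
      using halts[of e] found[of e y] computes_deterministic[of ?f "[e]"] by blast
  qed (rule pick)
qed

text \<open>A record of computations, two inputs, and the outputs of the program on these inputs.\<close>

type_synonym candidate = "claim list \<times> nat \<times> nat \<times> nat \<times> nat"

text \<open>The number \<open>e\<close> is arbitrary, so the outputs need not be codes of words in three letters; this is
  part of the test, as every relator that is found has to be an element of the free group.\<close>

definition witnesses :: "nat \<Rightarrow> candidate \<Rightarrow> bool" where
  "witnesses e c \<longleftrightarrow> (let D = fst c; x = fst (snd c); x' = fst (snd (snd c));
      y = fst (snd (snd (snd c))); y' = snd (snd (snd (snd c))) in
    derivation D \<and> (e, [x], y) \<in> set D \<and> (e, [x'], y') \<in> set D \<and> y \<noteq> y' \<and>
    enc (decode_word y) = y \<and> enc (decode_word y') = y' \<and>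
    (\<forall>a\<in>set (decode_word y). fst a < 3) \<and> (\<forall>a\<in>set (decode_word y'). fst a < 3) \<and>
    agree (e + 2) (decode_word y) (decode_word y'))"

definition left_word :: "candidate \<Rightarrow> nat word" where
  "left_word c = decode_word (fst (snd (snd (snd c))))"

definition right_word :: "candidate \<Rightarrow> nat word" where
  "right_word c = decode_word (snd (snd (snd (snd c))))"

definition relator :: "candidate \<Rightarrow> nat word" where
  "relator c = reduce (left_word c @ inv_word (right_word c))"

lemma computable_witnesses: "computable (\<lambda>p. witnesses (fst p) (snd p))"
  unfolding witnesses_def Let_def by (intro computable_intros computable_derivation computable_decode_word computable_agree)

lemma computable_relator: "computable relator"
proof -
  have "computable (\<lambda>c. relator c)"
    unfolding relator_def left_word_def right_word_def
    by (intro computable_reduce computable_inv_word computable_decode_word computable_intros)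
  then show ?thesis by simp
qed

lemma witnesses_words:
  assumes "witnesses e c"
  shows "left_word c \<noteq> right_word c" "fst ` set (left_word c) \<subseteq> {..<3}"
    "fst ` set (right_word c) \<subseteq> {..<3}" "agree (e + 2) (left_word c) (right_word c)"
  using assms by (auto simp: witnesses_def Let_def left_word_def right_word_def)

lemma witnesses_sound:
  assumes "witnesses (prog_code f) c"
    and W: "word_code ` W = {y. \<exists>x. computes f [x] y}"
  shows "left_word c \<in> W" "right_word c \<in> W"
proof -
  have in_W: "decode_word y \<in> W" if "derivation D" "(prog_code f, [x], y) \<in> set D" for x y D
  proof -
    have "y \<in> word_code ` W" using derivation_sound[OF that] W by blast
    then show ?thesis by (auto simp: word_code_enc decode_word_enc)
  qed
  show "left_word c \<in> W" "right_word c \<in> W"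
    using assms(1) in_W by (auto simp: witnesses_def Let_def left_word_def right_word_def)
qed

lemma witnesses_complete:
  assumes W: "word_code ` W = {y. \<exists>x. computes f [x] y}" "W \<subseteq> carrier F3"
    and uv: "u \<in> W" "v \<in> W" "u \<noteq> v" "agree (prog_code f + 2) u v"
  shows "\<exists>c. witnesses (prog_code f) c"
proof -
  have "enc u \<in> word_code ` W" "enc v \<in> word_code ` W" using uv by (auto simp: word_code_enc)
  then obtain x x' where "computes f [x] (enc u)" "computes f [x'] (enc v)" using W(1) by auto
  then obtain D D' where "derivation D" "(prog_code f, [x], enc u) \<in> set D"
      "derivation D'" "(prog_code f, [x'], enc v) \<in> set D'"
    unfolding computes_iff_derivable by auto
  moreover have "fst ` set u \<subseteq> {..<3}" "fst ` set v \<subseteq> {..<3}"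
    using subsetD[OF W(2) uv(1)] subsetD[OF W(2) uv(2)] by (simp_all add: carrier_free_group)
  ultimately have "witnesses (prog_code f) (D @ D', x, x', enc u, enc v)"
    using uv(3,4) by (fastforce simp: witnesses_def decode_word_enc derivation_append)
  then show ?thesis by blast
qed

text \<open>There are only finitely many possibilities for the coefficients of degree less than \<open>k\<close>.\<close>

lemma exists_agreeing_pair:
  assumes "infinite W" shows "\<exists>u\<in>W. \<exists>v\<in>W. u \<noteq> v \<and> agree k u v"
proof -
  let ?sig = "\<lambda>u. map (magnus_coef u) (monomials k)"
  have "?sig ` W \<subseteq> {bs. set bs \<subseteq> UNIV \<and> length bs = length (monomials k)}" by auto
  moreover have "finite {bs :: bool list. set bs \<subseteq> UNIV \<and> length bs = length (monomials k)}"
    by (rule finite_lists_length_eq) simp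
  ultimately have "finite (?sig ` W)" by (rule finite_subset)
  with assms have "\<not> inj_on ?sig W" using finite_imageD by blast
  then obtain u v where "u \<in> W" "v \<in> W" "u \<noteq> v" "?sig u = ?sig v" by (auto simp: inj_on_def)
  then show ?thesis by (auto simp: agree_iff)
qed

theorem theorem1p1:
  shows "\<exists>G :: nat word set monoid. dehn_monster G"
proof -
  have "surj (enc :: candidate \<Rightarrow> nat)"
    by (intro surj_enc_prod surj_enc_list surj_enc_nat)
  then obtain pick t where pick: "\<And>e. \<exists>c. witnesses e c \<Longrightarrow> witnesses e (pick e)"
    and t: "\<And>e y. computes t [e] y \<longleftrightarrow> (\<exists>c. witnesses e c) \<and> y = enc (relator (pick e))"
    by (rule computable_choice[OF computable_witnesses computable_relator]) blast
  define E where "E = {e. \<exists>c. witnesses e c}"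
  have pick: "witnesses e (pick e)" if "e \<in> E" for e
    using that pick unfolding E_def by blast
  have t: "computes t [e] y \<longleftrightarrow> e \<in> E \<and> y = enc (relator (pick e))" for e y
    unfolding t E_def by blast
  define R where "R = (\<lambda>e. relator (pick e)) ` E"
  \<comment> \<open>The counting argument wants a relator for every \<open>e\<close>; the empty word is a harmless default.\<close>
  define r where "r = (\<lambda>e. if e \<in> E then relator (pick e) else [])"
  have "relator (pick e) \<in> carrier F3" if "e \<in> E" for e
    using witnesses_words(2,3)[OF pick[OF that]] unfolding relator_def
    by (intro reduce_in_free_group) (simp add: image_Un)
  then have R_carrier: "R \<subseteq> carrier F3" by (auto simp: R_def)
  have R_range: "R \<subseteq> range r"
  proof
    fix w assume "w \<in> R"
    then obtain e where "e \<in> E" "w = relator (pick e)" by (auto simp: R_def)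
    then have "w = r e" by (simp add: r_def)
    then show "w \<in> range r" by simp
  qed
  have deep: "deep N (e + 2) (r e)" for N e
    using agree_deep[OF witnesses_words(4)[OF pick[of e]]] deep_Nil by (simp only: r_def relator_def if_split) blast
  have R_ce: "computably_enumerable R"
    unfolding computably_enumerable_def ce_nat_def
  proof (intro exI)
    show "word_code ` R = {y. \<exists>x. computes t [x] y}"
      by (auto simp only: R_def t word_code_enc image_image)
  qed
  let ?K = "normal_closure F3 R"
  let ?G = "presented_group {..<3} R"
  let ?x = "\<lambda>i. ?K #>\<^bsub>F3\<^esub> [(i, False)]"
  interpret normal ?K F3 by (rule normal_closure_normal[OF group_free_group R_carrier])
  have group: "group ?G" unfolding presented_group_def by (rule factorgroup_is_group)
  have carrier_G: "carrier ?G = (\<lambda>w. ?K #>\<^bsub>F3\<^esub> w) ` carrier F3"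
    by (auto simp: presented_group_def FactGroup_def RCOSETS_def)
  have x: "?x ` {..<3} \<subseteq> carrier ?G"
    unfolding carrier_G by (auto simp: carrier_free_group reduced_def)
  have "generate ?G (?x ` {..<3}) = carrier ?G"
  proof
    show "generate ?G (?x ` {..<3}) \<subseteq> carrier ?G"
      using group.generate_incl[OF group x] .
    show "carrier ?G \<subseteq> generate ?G (?x ` {..<3})"
    proof
      fix C assume "C \<in> carrier ?G"
      then obtain w where w: "w \<in> carrier F3" "C = ?K #>\<^bsub>F3\<^esub> w" by (auto simp: carrier_G)
      then have "C = word_value ?G ?x w" using word_value_coset[OF R_carrier] by simp
      with w(1) show "C \<in> generate ?G (?x ` {..<3})"
        using word_value_generate[of w "{..<3}" ?G ?x] by (simp add: carrier_free_group)
    qed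
  qed
  moreover have "bij_betw ?x {..<3} (?x ` {..<3})"
    using generators_distinct[OF R_carrier R_range deep] by (auto intro!: inj_on_imp_bij_betw inj_onI)
  moreover have "\<exists>u\<in>W. \<exists>v\<in>W. u \<noteq> v \<and> word_value ?G ?x u = word_value ?G ?x v"
    if W: "W \<subseteq> carrier F3" "infinite W" "computably_enumerable W" for W
  proof -
    from W(3) obtain f where f: "word_code ` W = {y. \<exists>x. computes f [x] y}"
      unfolding computably_enumerable_def ce_nat_def by blast
    let ?e = "prog_code f"
    have ex: "?e \<in> E"
      using exists_agreeing_pair[OF W(2)] witnesses_complete[OF f W(1)] unfolding E_def by blast
    let ?u = "left_word (pick ?e)" and ?v = "right_word (pick ?e)"
    have uv: "?u \<in> W" "?v \<in> W" "?u \<noteq> ?v"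
      using witnesses_sound[OF pick[OF ex] f] witnesses_words(1)[OF pick[OF ex]] by auto
    then have carrier: "?u \<in> carrier F3" "?v \<in> carrier F3" using W(1) by auto
    have "relator (pick ?e) \<in> ?K" using ex normal_closure_superset[of R F3] by (auto simp: R_def)
    moreover have "?u = relator (pick ?e) \<otimes>\<^bsub>F3\<^esub> ?v"
    proof -
      have "reduce (?u @ inv_word ?v @ ?v) = reduce ?u"
        using reduce_append_inv_word[of "inv_word ?v" "[]"] reduce_append_reduce[of ?u "inv_word ?v @ ?v"]
        by (simp add: reduce_def[of "[]"])
      with carrier show ?thesis
        by (simp add: relator_def mult_free_group reduce_reduce_append reduce_reduced carrier_free_group)
    qed
    ultimately have "?u \<in> ?K #>\<^bsub>F3\<^esub> ?v" by (auto simp: r_coset_def)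
    then have "?K #>\<^bsub>F3\<^esub> ?u = ?K #>\<^bsub>F3\<^esub> ?v"
      using repr_independence[OF _ carrier(2) is_subgroup] by simp
    then have "word_value ?G ?x ?u = word_value ?G ?x ?v"
      using word_value_coset[OF R_carrier] carrier by simp
    with uv show ?thesis by blast
  qed
  ultimately have "algorithmically_finite ?G"
    unfolding algorithmically_finite_def
    using x by (intro exI[of _ "?x ` {..<3}"] exI[of _ "3::nat"] exI[of _ ?x]) blast
  moreover have "recursively_presented ?G"
    unfolding recursively_presented_def
    using R_carrier R_ce iso_refl by blast
  moreover have "infinite (carrier ?G)"
    using R_carrier R_range deep by (rule infinite_presented_group)
  ultimately have "dehn_monster ?G" using group by (simp add: dehn_monster_def)
  then show ?thesis by blast
qed

end
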